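(* Let $f\colon \mathbb{H}\to\mathbb{C}$ be a holomorphic modular function with respect to $\mathrm{SL}_2(\mathbb{Z})$. Let $k\ge 1$, and let $\{a_n^{(1)}\}_{n=1}^{\infty},\dots,\{a_n^{(k)}\}_{n=1}^{\infty}$ be sequences in $\mathbb{Z}_{\ge 0}$, each diverging to $+\infty$, such that the limits \[ a^{(i)} := \lim_{n\to\infty}\frac{a_n^{(i)}}{a_n^{(1)}+\cdots+a_n^{(k)}},\qquad 1\le i\le k, \] exist. Let $V_0,\dots,V_k$ be even words (possibly empty) and let $W_1,\dots,W_k$ be non-empty even words. Put \[ w_i := [\overline{W_i}]\quad (1\le i\le k),\qquad w^{(n)} := [\overline{V_0 W_1^{a_n^{(1)}} V_1 W_2^{a_n^{(2)}} V_2\cdots W_k^{a_n^{(k)}} V_k}], \] the latter being defined for all sufficiently large $n$. Then \[ \lim_{n\to\infty} f(w^{(n)}) = \frac{a^{(1)} N(W_1)\,\widetilde{f}(w_1)+\cdots+a^{(k)} N(W_k)\,\widetilde{f}(w_k)}{a^{(1)} N(W_1)\,\widetilde{1}(w_1)+\cdots+a^{(k)} N(W_k)\,\widetilde{1}(w_k)}. \]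
   Context: $\mathbb{H}=\{z\in\mathbb{C}\mid \mathrm{Im}(z)>0\}$ is the upper half plane, with $\mathrm{SL}_2(\mathbb{Z})$ acting by Möbius transformations; $f\colon\mathbb{H}\to\mathbb{C}$ is holomorphic and is a (weight $0$) modular function for $\mathrm{SL}_2(\mathbb{Z})$, in particular $f(\gamma z)=f(z)$ for all $\gamma\in \mathrm{SL}_2(\mathbb{Z})$. Values at real quadratic numbers. For a real quadratic number $w$ with non-trivial Galois conjugate $w'$, set \[ \eta_w := \left(\frac{1}{z-w'}-\frac{1}{z-w}\right)dz . \] Let $\mathrm{SL}_2(\mathbb{Z})_w$ be the stabilizer of $w$ and let $\gamma_w=\begin{pmatrix} * & *\\ c& d\end{pmatrix}$ be the unique element of $\mathrm{SL}_2(\mathbb{Z})_w$ such that $\mathrm{SL}_2(\mathbb{Z})_w=\{\pm\gamma_w^n\mid n\in\mathbb{Z}\}$ and $\varepsilon_w:=cw+d>1$. For $z_0\in\mathbb{H}$ define \[ \widetilde{f}(w):=\int_{z_0}^{\gamma_w z_0} f\,\eta_w,\qquad \widetilde{1}(w):=\int_{z_0}^{\gamma_w z_0}\eta_w, \] where the integrals are along any path in $\mathbb{H}$; they are independent of $z_0$. The value of $f$ at $w$ is $f(w):=\widetilde{f}(w)/\widetilde{1}(w)$. Words and continued fractions. $[k_1,k_2,k_3,\dots]:=k_1+\cfrac{1}{k_2+\cfrac{1}{k_3+\cdots}}$. An even word is a finite sequence $W=(k_1,\dots,k_r)$ of positive integers with $r\ge 0$ even. The product of even words is their concatenation, and $W^a$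 denotes the $a$-fold concatenation of $W$ ($W^0$ is the empty word). For a non-empty even word $W=(k_1,\dots,k_r)$, $[\overline{W}]$ denotes the purely periodic continued fraction $[k_1,\dots,k_r,k_1,\dots,k_r,\dots]$ (a real quadratic number), and \[ N(W):=\max\{n\in\mathbb{Z}_{>0}\mid \text{there is an even word } W_1 \text{ with } W=W_1^n\}. \] *)

theory Defs
  imports "HOL-Complex_Analysis.Complex_Analysis" "HOL-Algebra.Group"
begin

definition upper_half_plane :: "complex set" where
  "upper_half_plane = {z. Im z > 0}"

definition SL2Z :: "(int^2^2) monoid" where
  "SL2Z = \<lparr>carrier = {A. det A = 1}, monoid.mult = (**), one = mat 1\<rparr>"

lemma group_SL2Z: "group SL2Z"
proof (rule groupI)
  fix A :: "int^2^2"
  assume "A \<in> carrier SL2Z"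
  hence det_A: "A$1$1 * A$2$2 - A$1$2 * A$2$1 = 1"
    by (simp add: SL2Z_def det_2)
  define B :: "int^2^2" where
    "B = (\<chi> i j. if i = j then A$(if i = 1 then 2 else 1)$(if i = 1 then 2 else 1) else - A$i$j)"
  have "det B = 1"
    using det_A by (simp add: B_def det_2 algebra_simps)
  moreover have "B ** A = mat 1"
    using det_A
    by (simp add: B_def vec_eq_iff forall_2 matrix_matrix_mult_def sum_2 mat_def algebra_simps)
  ultimately show "\<exists>B\<in>carrier SL2Z. B \<otimes>\<^bsub>SL2Z\<^esub> A = \<one>\<^bsub>SL2Z\<^esub>"
    by (auto simp: SL2Z_def)
qed (auto simp: SL2Z_def det_mul matrix_mul_assoc)

text \<open>The Moebius action, on complex as well as on real arguments.\<close>

definition moebius :: "int^2^2 \<Rightarrow> 'a::field \<Rightarrow> 'a" where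
  "moebius A z =
     (of_int (A$1$1) * z + of_int (A$1$2)) / (of_int (A$2$1) * z + of_int (A$2$2))"

text \<open>
  The last condition is meromorphy at the cusp: \<open>f\<close> is a function \<open>F\<close> of \<open>q = exp (2 \<pi> \<i> z)\<close>
  having a Laurent expansion with finite principal part at \<open>q = 0\<close>.
\<close>

definition holomorphic_modular_function :: "(complex \<Rightarrow> complex) \<Rightarrow> bool" where
  "holomorphic_modular_function f \<longleftrightarrow>
     f holomorphic_on upper_half_plane \<and>
     (\<forall>A\<in>carrier SL2Z. \<forall>z\<in>upper_half_plane. f (moebius A z) = f z) \<and>
     (\<exists>F. F meromorphic_on {0} \<and>
        (\<forall>z\<in>upper_half_plane. f z = F (exp (2 * of_real pi * \<i> * z))))"

text \<open>
  For an irrational root \<open>w\<close> of an integral quadratic polynomial, that polynomial is unique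
  up to scaling, and \<open>galois_conj w\<close> is its other root.
\<close>

definition galois_conj :: "real \<Rightarrow> real" where
  "galois_conj w = (THE w'. w' \<noteq> w \<and>
     (\<exists>a b c :: int. a \<noteq> 0 \<and>
        of_int a * w\<^sup>2 + of_int b * w + of_int c = 0 \<and>
        of_int a * w'\<^sup>2 + of_int b * w' + of_int c = 0))"

definition SL2Z_stabilizer :: "real \<Rightarrow> (int^2^2) set" where
  "SL2Z_stabilizer w = {A \<in> carrier SL2Z. moebius A w = w}"

definition fund_stabilizer :: "real \<Rightarrow> int^2^2" where
  "fund_stabilizer w = (THE A. A \<in> SL2Z_stabilizer w \<and>
     SL2Z_stabilizer w =
       (\<Union>n::int. {A [^]\<^bsub>SL2Z\<^esub> n, - (A [^]\<^bsub>SL2Z\<^esub> n)}) \<and>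
     of_int (A$2$1) * w + of_int (A$2$2) > 1)"

definition eta :: "real \<Rightarrow> complex \<Rightarrow> complex" where
  "eta w z = 1 / (z - of_real (galois_conj w)) - 1 / (z - of_real w)"

text \<open>
  The common value of the integrals of \<open>f \<eta>\<^sub>w\<close> along all paths in the upper half plane from
  some \<open>z\<^sub>0\<close> to \<open>\<gamma>\<^sub>w z\<^sub>0\<close>, for all base points \<open>z\<^sub>0\<close>.
\<close>

definition cycle_integral :: "(complex \<Rightarrow> complex) \<Rightarrow> real \<Rightarrow> complex" where
  "cycle_integral f w = (THE I. \<forall>z0 g.
     z0 \<in> upper_half_plane \<and> valid_path g \<and> path_image g \<subseteq> upper_half_plane \<and>
     pathstart g = z0 \<and> pathfinish g = moebius (fund_stabilizer w) z0 \<longrightarrow>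
     ((\<lambda>z. f z * eta w z) has_contour_integral I) g)"

definition quadratic_value :: "(complex \<Rightarrow> complex) \<Rightarrow> real \<Rightarrow> complex" where
  "quadratic_value f w = cycle_integral f w / cycle_integral (\<lambda>_. 1) w"

definition even_word :: "nat list \<Rightarrow> bool" where
  "even_word W \<longleftrightarrow> even (length W) \<and> (\<forall>k\<in>set W. k > 0)"

definition word_power :: "nat list \<Rightarrow> nat \<Rightarrow> nat list" where
  "word_power W a = concat (replicate a W)"

text \<open>The value on the empty list is a dummy.\<close>

fun finite_cfrac :: "nat list \<Rightarrow> real" where
  "finite_cfrac [] = 0"
| "finite_cfrac [k] = of_nat k"
| "finite_cfrac (k # l # ks) = of_nat k + 1 / finite_cfrac (l # ks)"

definition infinite_cfrac :: "(nat \<Rightarrow> nat) \<Rightarrow> real" where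
  "infinite_cfrac k = lim (\<lambda>n. finite_cfrac (map k [0..<Suc n]))"

definition periodic_cfrac :: "nat list \<Rightarrow> real" where
  "periodic_cfrac W = infinite_cfrac (\<lambda>i. W ! (i mod length W))"

definition word_exponent :: "nat list \<Rightarrow> nat" where
  "word_exponent W = Max {n. n > 0 \<and> (\<exists>W1. even_word W1 \<and> W = word_power W1 n)}"

text \<open>The word \<open>V\<^sub>0 W\<^sub>1\<^bsup>a\<^sub>1\<^esup> V\<^sub>1 \<dots> W\<^sub>k\<^bsup>a\<^sub>k\<^esup> V\<^sub>k\<close>.\<close>

definition composite_word ::
    "nat \<Rightarrow> (nat \<Rightarrow> nat list) \<Rightarrow> (nat \<Rightarrow> nat list) \<Rightarrow> (nat \<Rightarrow> nat) \<Rightarrow> nat list" where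
  "composite_word k V W a =
     V 0 @ concat (map (\<lambda>i. word_power (W i) (a i) @ V i) [1..<Suc k])"

end

theory Submission imports Defs begin

text \<open>
  A word \<open>U = (k\<^sub>1, \<dots>, k\<^sub>r)\<close> acts on the right half line through the product \<open>M\<^sub>U\<close> of the matrices
  with rows \<open>(k\<^sub>i, 1)\<close> and \<open>(1, 0)\<close>. If \<open>U\<close> is even and non-empty, \<open>M\<^sub>U\<close> lies in \<open>SL\<^sub>2(\<int>)\<close>, its
  attracting fixed point is \<open>w = [U, U, \<dots>]\<close>, and its repelling fixed point is the Galois
  conjugate \<open>w'\<close>, which lies in \<open>(-1, 0)\<close> (\<open>periodic_cfrac_fixpoints\<close>).

  The number \<open>I(U)\<close>, the integral of \<open>f \<eta>\<^sub>w\<close> from \<open>\<i>\<close> to \<open>M\<^sub>U \<i>\<close>, is \<open>N(U)\<close> times the cycle integral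
  of \<open>f\<close> at \<open>w\<close>, because \<open>M\<^sub>U\<close> is the \<open>N(U)\<close>-th power of the fundamental stabilizer
  (\<open>cycle_integral_word\<close>). Here one has to know the stabilizer: an element with eigenvalue
  \<open>c w + d > 1\<close> is itself a word matrix, by the Euclidean algorithm (\<open>euclid_word\<close>,
  \<open>stabilizer_word\<close>); it commutes with \<open>M\<^sub>U\<close>, word matrices determine their words, and commuting
  words are powers of a common word. So \<open>f(w)\<close> is the quotient of \<open>I(U)\<close> for \<open>f\<close> and for the constant
  function \<open>1\<close>, in which \<open>N(U)\<close> cancels.

  For a composite word, the path from \<open>\<i>\<close> to \<open>M\<^sub>U \<i>\<close> is cut at the images of \<open>\<i>\<close> under the prefixes of
  \<open>U\<close>. By modularity the piece between the prefixes \<open>X\<close> and \<open>X B\<close> is the integral from \<open>\<i>\<close> to \<open>M\<^sub>B \<i>\<close> of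
  \<open>f\<close> against the kernel with poles \<open>M\<^sub>X\<inverse> w\<close> and \<open>M\<^sub>X\<inverse> w'\<close> (\<open>word_integral_append\<close>). When
  \<open>B = W\<^sub>i\<close> is one of the \<open>a\<close> consecutive copies of \<open>W\<^sub>i\<close>, the first pole has a continued fraction that
  starts with all the copies still to come, and the second one is governed in the same way by the copies
  already passed. Both are therefore exponentially close to \<open>w\<^sub>i\<close> and \<open>w\<^sub>i'\<close> away from the two ends of the
  block, and the errors sum to a geometric series: the block contributes \<open>a I(W\<^sub>i) + O(1)\<close>, with a bound
  that depends on \<open>W\<^sub>i\<close> and \<open>f\<close> alone (\<open>word_power_integral_estimate\<close>). The words \<open>V\<^sub>i\<close>
  contribute \<open>O(1)\<close>.

  Hence \<open>I(U\<^sub>n) = \<Sum>\<^sub>i a\<^sub>n\<^sup>i I(W\<^sub>i) + O(1)\<close> for \<open>f\<close> and for \<open>1\<close>; dividing by \<open>\<Sum>\<^sub>i a\<^sub>n\<^sup>i\<close> and taking the quotient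
  gives the limit. Its denominator does not vanish: for the constant function, \<open>I(W)\<close> has real part
  \<open>2 ln (c w + d) > 0\<close> (\<open>Re_segment_integral_one\<close>), and the limiting weights are nonnegative
  with sum \<open>1\<close>.
\<close>

\<comment> \<open>Leaves \<open>$\<close> to the entries of vectors and matrices.\<close>
no_notation fps_nth (infixl "$" 75)

section \<open>Moebius transformations\<close>

abbreviation denom :: "int^2^2 \<Rightarrow> 'a::field \<Rightarrow> 'a" where
  "denom A z \<equiv> of_int (A$2$1) * z + of_int (A$2$2)"

lemma moebius_mult:
  fixes z :: "'a::field"
  assumes "denom B z \<noteq> 0"
  shows "moebius (A ** B) z = moebius A (moebius B z)"
proof -
  define u v where "u = of_int (B$1$1) * z + of_int (B$1$2)"
    and "v = denom B z"
  have v: "v \<noteq> 0" using assms by (simp add: v_def)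
  have "moebius A (moebius B z) = (of_int (A$1$1) * (u/v) + of_int (A$1$2)) / (of_int (A$2$1) * (u/v) + of_int (A$2$2))"
    by (simp add: moebius_def u_def v_def)
  also have "\<dots> = ((of_int (A$1$1) * u + of_int (A$1$2) * v) / v) / ((of_int (A$2$1) * u + of_int (A$2$2) * v) / v)"
    using v by (simp add: add_divide_distrib)
  also have "\<dots> = (of_int (A$1$1) * u + of_int (A$1$2) * v) / (of_int (A$2$1) * u + of_int (A$2$2) * v)"
    using v by simp
  also have "\<dots> = moebius (A ** B) z"
    by (simp add: moebius_def u_def v_def matrix_matrix_mult_def sum_2 algebra_simps)
  finally show ?thesis ..
qed

lemma moebius_mat_1: "moebius (mat 1) z = z"
  by (simp add: moebius_def mat_def)

lemma moebius_of_real: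
  "moebius A (of_real x :: complex) = of_real (moebius A x)"
  by (simp add: moebius_def)

lemma matrix_eq_2:
  fixes A B :: "'a^2^2"
  shows "A = B \<longleftrightarrow> A$1$1 = B$1$1 \<and> A$1$2 = B$1$2 \<and> A$2$1 = B$2$1 \<and> A$2$2 = B$2$2"
  by (auto simp: vec_eq_iff forall_2)

lemma det_2_eq_1:
  fixes A :: "int^2^2"
  assumes "det A = 1"
  shows "of_int (A$1$1) * of_int (A$2$2) - of_int (A$1$2) * of_int (A$2$1) = (1::'a::ring_1)"
proof -
  have "A$1$1 * A$2$2 - A$1$2 * A$2$1 = 1" using assms by (simp add: det_2)
  from arg_cong[OF this, of "of_int :: int \<Rightarrow> 'a"] show ?thesis by simp
qed

lemma moebius_denominator_nonzero:
  fixes A :: "int^2^2"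
  assumes "det A = 1" "z \<in> upper_half_plane"
  shows "denom A z \<noteq> (0::complex)"
proof
  assume *: "denom A z = (0::complex)"
  from arg_cong[OF this, of Im] assms(2) have c: "A$2$1 = 0"
    by (auto simp: upper_half_plane_def)
  with * have "A$2$2 = 0" by auto
  with c assms(1) show False by (simp add: det_2)
qed

text \<open>
  The imaginary part of \<open>A z\<close> is \<open>Im z / |c z + d|\<^sup>2\<close>.
\<close>

lemma moebius_upper_half_plane:
  assumes "det A = 1" "z \<in> upper_half_plane"
  shows "moebius A z \<in> upper_half_plane"
proof -
  define v where "v = of_int (A$2$1) * z + (of_int (A$2$2)::complex)"
  have v: "v \<noteq> 0" using moebius_denominator_nonzero[OF assms] by (simp add: v_def)
  have "moebius A z = (of_int (A$1$1) * z + of_int (A$1$2)) * cnj v / of_real ((cmod v)\<^sup>2)"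
    by (simp add: moebius_def complex_div_cnj[of _ v] flip: v_def)
  then have "Im (moebius A z) = Im ((of_int (A$1$1) * z + of_int (A$1$2)) * cnj v) / (cmod v)\<^sup>2"
    by (simp only: Im_divide_of_real)
  also have "Im ((of_int (A$1$1) * z + of_int (A$1$2)) * cnj v) = (of_int (A$1$1) * of_int (A$2$2) - of_int (A$1$2) * of_int (A$2$1)) * Im z"
    by (simp add: v_def algebra_simps)
  finally show ?thesis
    using assms v det_2_eq_1[OF assms(1), where ?'a=real] by (simp add: upper_half_plane_def)
qed

text \<open>
  The contraction towards a fixed point and the transformation behaviour of the integration kernel
  both rest on this identity.
\<close>

lemma moebius_diff:
  fixes x y :: "'a::field"
  assumes "det A = 1"
    and "denom A x \<noteq> 0" "denom A y \<noteq> 0"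
  shows "moebius A x - moebius A y =
    (x - y) / ((denom A x) * (denom A y))"
proof -
  have "(of_int (A$1$1) * x + of_int (A$1$2)) * (denom A y) -
        (of_int (A$1$1) * y + of_int (A$1$2)) * (denom A x) =
        (of_int (A$1$1) * of_int (A$2$2) - of_int (A$1$2) * of_int (A$2$1)) * (x - y)"
    by (simp add: algebra_simps)
  also have "\<dots> = x - y" using det_2_eq_1[OF assms(1), where ?'a='a] by simp
  finally show ?thesis using assms(2,3) by (simp add: moebius_def diff_frac_eq)
qed

section \<open>Matrices of continued fraction words\<close>

definition digit_matrix :: "nat \<Rightarrow> int^2^2" where
  "digit_matrix k = (\<chi> i j. if i = 1 \<and> j = 1 then int k else if i = 2 \<and> j = 2 then 0 else 1)"

lemma digit_matrix_nth [simp]: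
  "digit_matrix k $ 1 $ 1 = int k" "digit_matrix k $ 1 $ 2 = 1"
  "digit_matrix k $ 2 $ 1 = 1" "digit_matrix k $ 2 $ 2 = 0"
  by (simp_all add: digit_matrix_def)

fun word_matrix :: "nat list \<Rightarrow> int^2^2" where
  "word_matrix [] = mat 1"
| "word_matrix (k # ks) = digit_matrix k ** word_matrix ks"

lemma word_matrix_append: "word_matrix (U @ X) = word_matrix U ** word_matrix X"
  by (induction U) (simp_all add: matrix_mul_assoc)

lemma word_matrix_nth_Nil [simp]:
  "word_matrix [] $ 1 $ 1 = 1" "word_matrix [] $ 1 $ 2 = 0"
  "word_matrix [] $ 2 $ 1 = 0" "word_matrix [] $ 2 $ 2 = 1"
  by (simp_all add: mat_def)

lemma word_matrix_nth_Cons [simp]: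
  "word_matrix (k # U) $ 1 $ 1 = int k * word_matrix U $ 1 $ 1 + word_matrix U $ 2 $ 1"
  "word_matrix (k # U) $ 1 $ 2 = int k * word_matrix U $ 1 $ 2 + word_matrix U $ 2 $ 2"
  "word_matrix (k # U) $ 2 $ 1 = word_matrix U $ 1 $ 1"
  "word_matrix (k # U) $ 2 $ 2 = word_matrix U $ 1 $ 2"
  by (simp_all add: matrix_matrix_mult_def sum_2)

declare word_matrix.simps [simp del]

lemma det_word_matrix: "det (word_matrix U) = (-1) ^ length U"
proof (induction U)
  case (Cons k U)
  have "det (digit_matrix k) = -1" by (simp add: det_2)
  with Cons show ?case by (simp add: word_matrix.simps det_mul)
qed (simp add: word_matrix.simps)

text \<open>
  The entries decrease along rows and columns. These inequalities characterize the matrices of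
  non-empty words among the integral matrices of determinant \<open>1\<close> or \<open>-1\<close>, see \<open>euclid_word\<close>.
\<close>

lemma word_matrix_entries:
  assumes "\<forall>k\<in>set U. k > 0" "U \<noteq> []"
  shows "word_matrix U $ 2 $ 2 \<ge> 0"
    and "word_matrix U $ 2 $ 2 \<le> word_matrix U $ 1 $ 2"
    and "word_matrix U $ 2 $ 2 \<le> word_matrix U $ 2 $ 1"
    and "word_matrix U $ 1 $ 2 \<le> word_matrix U $ 1 $ 1"
    and "word_matrix U $ 2 $ 1 \<le> word_matrix U $ 1 $ 1"
proof -
  have "word_matrix U $ 2 $ 2 \<ge> 0 \<and> word_matrix U $ 2 $ 2 \<le> word_matrix U $ 1 $ 2 \<and>
    word_matrix U $ 2 $ 2 \<le> word_matrix U $ 2 $ 1 \<and> word_matrix U $ 1 $ 2 \<le> word_matrix U $ 1 $ 1 \<and>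
    word_matrix U $ 2 $ 1 \<le> word_matrix U $ 1 $ 1"
    using assms
  proof (induction U)
    case (Cons k U)
    show ?case
    proof (cases "U = []")
      case True
      then show ?thesis using Cons.prems by simp
    next
      case False
      with Cons have IH: "word_matrix U $ 2 $ 2 \<ge> 0" "word_matrix U $ 2 $ 2 \<le> word_matrix U $ 1 $ 2"
        "word_matrix U $ 2 $ 2 \<le> word_matrix U $ 2 $ 1" "word_matrix U $ 1 $ 2 \<le> word_matrix U $ 1 $ 1"
        "word_matrix U $ 2 $ 1 \<le> word_matrix U $ 1 $ 1" by auto
      have k: "int k \<ge> 1" using Cons.prems by auto
      have "word_matrix U $ 1 $ 2 \<le> int k * word_matrix U $ 1 $ 2"
           "word_matrix U $ 1 $ 1 \<le> int k * word_matrix U $ 1 $ 1"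
        using k IH by (simp_all add: mult_le_cancel_right1)
      moreover have "int k * word_matrix U $ 1 $ 2 \<le> int k * word_matrix U $ 1 $ 1"
        using k IH by (intro mult_left_mono) auto
      ultimately show ?thesis using IH by simp
    qed
  qed simp
  thus "word_matrix U $ 2 $ 2 \<ge> 0"
    and "word_matrix U $ 2 $ 2 \<le> word_matrix U $ 1 $ 2"
    and "word_matrix U $ 2 $ 2 \<le> word_matrix U $ 2 $ 1"
    and "word_matrix U $ 1 $ 2 \<le> word_matrix U $ 1 $ 1"
    and "word_matrix U $ 2 $ 1 \<le> word_matrix U $ 1 $ 1" by auto
qed

lemma even_word_pos: "even_word U \<Longrightarrow> \<forall>k\<in>set U. k > 0"
  by (simp add: even_word_def)

lemma det_word_matrix_even: "even_word U \<Longrightarrow> det (word_matrix U) = 1"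
  by (simp add: det_word_matrix even_word_def)

lemma even_word_matrix_pos:
  assumes "even_word U" "U \<noteq> []"
  shows "word_matrix U $ 2 $ 2 \<ge> 1"
proof -
  have pos: "\<forall>k\<in>set U. k > 0" using assms by (auto simp: even_word_def)
  note e = word_matrix_entries[OF pos assms(2)]
  have "word_matrix U $ 2 $ 2 \<noteq> 0"
  proof
    assume "word_matrix U $ 2 $ 2 = 0"
    then have "- (word_matrix U $ 1 $ 2 * word_matrix U $ 2 $ 1) = 1"
      using det_word_matrix_even[OF assms(1)] by (simp add: det_2)
    moreover have "word_matrix U $ 1 $ 2 * word_matrix U $ 2 $ 1 \<ge> 0" using e by (intro mult_nonneg_nonneg) auto
    ultimately show False by simp
  qed
  with e(1) show ?thesis by simp
qed

lemma even_word_append: "even_word U \<Longrightarrow> even_word X \<Longrightarrow> even_word (U @ X)"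
  by (auto simp: even_word_def)

lemma word_power_0 [simp]: "word_power W 0 = []"
  by (simp add: word_power_def)

lemma word_power_Suc: "word_power W (Suc n) = W @ word_power W n"
  by (simp add: word_power_def)

lemma even_word_power: "even_word W \<Longrightarrow> even_word (word_power W n)"
  by (induction n) (simp_all add: word_power_Suc even_word_append, simp add: even_word_def)

lemma length_word_power: "length (word_power W n) = n * length W"
  by (induction n) (simp_all add: word_power_Suc)

lemma word_power_add: "word_power W (m + n) = word_power W m @ word_power W n"
  by (induction m) (simp_all add: word_power_Suc)

lemma word_power_mult: "word_power (word_power W m) n = word_power W (m * n)"
  by (induction n) (simp_all add: word_power_Suc word_power_add)

lemma moebius_digit:
  fixes x :: "'a::field"
  assumes "x \<noteq> 0" shows "moebius (digit_matrix k) x = of_nat k + 1 / x"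
  using assms by (simp add: moebius_def field_simps)

lemma word_matrix_denominator_pos:
  assumes "\<forall>k\<in>set U. k > 0" "x > (0::real)"
  shows "denom (word_matrix U) x > 0"
    and "of_int (word_matrix U $ 1 $ 1) * x + of_int (word_matrix U $ 1 $ 2) > 0"
proof -
  have "denom (word_matrix U) x > 0 \<and>
        of_int (word_matrix U $ 1 $ 1) * x + of_int (word_matrix U $ 1 $ 2) > 0"
    using assms(1)
  proof (induction U)
    case (Cons k U)
    define u v where "u = x * real_of_int (word_matrix U $ 1 $ 1) + real_of_int (word_matrix U $ 1 $ 2)"
      and "v = x * real_of_int (word_matrix U $ 2 $ 1) + real_of_int (word_matrix U $ 2 $ 2)"
    have "u > 0" "v > 0" "k > 0" using Cons by (simp_all add: u_def v_def mult.commute)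
    then have "real k * u + v > 0" by (simp add: add_pos_pos)
    then show ?case using \<open>u > 0\<close> by (simp add: u_def v_def algebra_simps)
  qed (use assms(2) in simp)
  thus "denom (word_matrix U) x > 0"
    and "of_int (word_matrix U $ 1 $ 1) * x + of_int (word_matrix U $ 1 $ 2) > 0" by auto
qed

lemma moebius_word_pos:
  assumes "\<forall>k\<in>set U. k > 0" "x > (0::real)"
  shows "moebius (word_matrix U) x > 0"
  using word_matrix_denominator_pos[OF assms] by (simp add: moebius_def)

lemma moebius_word_append:
  assumes "\<forall>k\<in>set X. k > 0" "x > (0::real)"
  shows "moebius (word_matrix (U @ X)) x = moebius (word_matrix U) (moebius (word_matrix X) x)"
  using word_matrix_denominator_pos(1)[OF assms]
  by (simp add: word_matrix_append moebius_mult)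

lemma moebius_word_Cons:
  assumes "\<forall>k\<in>set U. k > 0" "x > (0::real)"
  shows "moebius (word_matrix (k # U)) x = real k + 1 / moebius (word_matrix U) x"
proof -
  have "moebius (word_matrix (k # U)) x = moebius (digit_matrix k) (moebius (word_matrix U) x)"
    unfolding word_matrix.simps
    by (rule moebius_mult) (use word_matrix_denominator_pos(1)[OF assms] in simp)
  then show ?thesis using moebius_word_pos[OF assms] by (simp add: moebius_digit)
qed

text \<open>
  The first letter is the integer part of the value at any finite \<open>x > 1\<close>, for instance at \<open>2\<close>. The
  endpoints fail: \<open>(k)\<close> has the value \<open>k + 1\<close> at \<open>1\<close>, and \<open>(k - 1, 1)\<close> has the value \<open>k\<close> at \<open>\<infinity>\<close>.
\<close>

lemma word_matrix_inj:
  assumes "\<forall>k\<in>set U. k > 0" "\<forall>k\<in>set X. k > 0" "word_matrix U = word_matrix X"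
  shows "U = X"
  using assms
proof (induction U arbitrary: X)
  have nontrivial: "word_matrix [] \<noteq> word_matrix (k # Y)" if "\<forall>k\<in>set (k # Y). k > 0" for k Y
  proof
    assume "word_matrix [] = word_matrix (k # Y)"
    then have "word_matrix (k # Y) $ 2 $ 1 = 0" "word_matrix (k # Y) $ 2 $ 2 = 1"
      by (metis word_matrix_nth_Nil)+
    with word_matrix_entries(3)[OF that] show False by simp
  qed
  {
    case Nil
    then show ?case using nontrivial by (cases X) auto
  next
    case (Cons k U)
    then obtain l Y where X: "X = l # Y" using nontrivial[OF Cons.prems(1)] by (cases X) auto
    have floor: "\<lfloor>moebius (word_matrix (m # Z)) (2::real)\<rfloor> = int m" if "\<forall>k\<in>set Z. k > 0" for m Z
    proof -
      have "moebius (word_matrix Z) (2::real) > 1"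
      proof (cases Z)
        case Nil
        then show ?thesis by (simp add: moebius_def)
      next
        case (Cons j Z')
        then have "moebius (word_matrix Z) (2::real) = real j + 1 / moebius (word_matrix Z') 2"
          using that by (simp add: moebius_word_Cons)
        moreover have "moebius (word_matrix Z') (2::real) > 0" "j \<ge> 1"
          using that Cons by (auto intro!: moebius_word_pos)
        ultimately show ?thesis by (smt (verit) of_nat_1 of_nat_mono zero_less_divide_1_iff)
      qed
      then show ?thesis using that by (simp add: moebius_word_Cons floor_unique)
    qed
    have kl: "k = l" using Cons.prems X floor[of U k] floor[of Y l] by auto
    have e: "word_matrix (k # U) = word_matrix (k # Y)" using Cons.prems(3) unfolding X kl .
    have *: "word_matrix U $ 1 $ 1 = word_matrix Y $ 1 $ 1" "word_matrix U $ 1 $ 2 = word_matrix Y $ 1 $ 2"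
      using arg_cong[OF e, of "\<lambda>A. A$2$1"] arg_cong[OF e, of "\<lambda>A. A$2$2"] by simp_all
    have "word_matrix U $ 2 $ 1 = word_matrix Y $ 2 $ 1" "word_matrix U $ 2 $ 2 = word_matrix Y $ 2 $ 2"
      using arg_cong[OF e, of "\<lambda>A. A$1$1"] arg_cong[OF e, of "\<lambda>A. A$1$2"] * by simp_all
    with * have "word_matrix U = word_matrix Y" unfolding matrix_eq_2 by blast
    with Cons.IH Cons.prems have "U = Y" by (auto simp: X)
    with kl X show ?case by simp
  }
qed

text \<open>
  The Euclidean algorithm on the first column splits off one digit matrix after the other.
\<close>

lemma euclid_word:
  fixes A :: "int^2^2"
  assumes "0 \<le> A$2$2" "A$2$2 \<le> A$1$2" "A$2$2 \<le> A$2$1" "A$1$2 \<le> A$1$1" "A$2$1 \<le> A$1$1"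
    and "\<bar>det A\<bar> = 1"
  shows "\<exists>U. (\<forall>k\<in>set U. k > 0) \<and> word_matrix U = A"
  using assms
proof (induction "nat (A$2$1)" arbitrary: A rule: less_induct)
  case less
  define a b c d where defs: "a = A$1$1" "b = A$1$2" "c = A$2$1" "d = A$2$2"
  have le: "0 \<le> d" "d \<le> b" "d \<le> c" "b \<le> a" "c \<le> a" and det: "\<bar>a * d - b * c\<bar> = 1"
    using less.prems by (simp_all add: defs det_2)
  \<comment> \<open>For \<open>c = 1\<close> and \<open>d = 1\<close> a division step would leave the class of admissible matrices: the last
    partial quotient has to be split as \<open>[b, 1]\<close>.\<close>
  consider "d = 0" | "d \<ge> 1" "c = 1" | "d \<ge> 1" "c \<ge> 2" using le by linarith
  then show ?case
  proof cases
    case 1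
    with det le have "b = 1" "c = 1" by (auto simp: abs_mult zmult_eq_1_iff abs_zmult_eq_1)
    then have "word_matrix [nat a] = A" "nat a > 0" using 1 le
      by (auto simp: matrix_eq_2 simp flip: defs)
    then show ?thesis by (intro exI[of _ "[nat a]"]) auto
  next
    case 2
    with le det have "d = 1" "a = b + 1" by auto
    then have "word_matrix [nat b, 1] = A" "nat b > 0" using 2 le
      by (auto simp: matrix_eq_2 simp flip: defs)
    then show ?thesis by (intro exI[of _ "[nat b, 1]"]) auto
  next
    case 3
    define k where "k = a div c"
    define r s where "r = a mod c" and "s = b - k * d"
    have a: "a = k * c + r" by (simp add: k_def r_def)
    have k: "k \<ge> 1" using 3 le pos_imp_zdiv_pos_iff[of c a] by (simp add: k_def)
    have r: "0 \<le> r" "r < c" using 3 by (auto simp: r_def)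
    have det': "\<bar>c * s - d * r\<bar> = 1"
    proof -
      have "c * s - d * r = - (a * d - b * c)" unfolding a s_def by (simp add: algebra_simps)
      with det show ?thesis by simp
    qed
    \<comment> \<open>In each of the following steps a violation would make the determinant at least \<open>c \<ge> 2\<close> in
      absolute value.\<close>
    have s0: "s \<ge> 0"
    proof (rule ccontr)
      assume "\<not> s \<ge> 0"
      then have "c * s \<le> c * (-1)" using 3 by (intro mult_left_mono) auto
      moreover have "d * r \<ge> 0" using 3 r by simp
      ultimately show False using det' 3 by linarith
    qed
    have sr: "s \<le> r"
    proof (rule ccontr)
      assume "\<not> s \<le> r"
      then have "c * s \<ge> c * (r + 1)" using 3 by (intro mult_left_mono) auto
      moreover have "d * r \<le> c * r" using le r by (intro mult_right_mono) auto
      ultimately show False using det' 3 by (simp add: algebra_simps)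
    qed
    have sd: "s \<le> d"
    proof (rule ccontr)
      assume "\<not> s \<le> d"
      then have "c * s \<ge> c * (d + 1)" using 3 by (intro mult_left_mono) auto
      moreover have "d * r \<le> d * c" using le r by (intro mult_left_mono) auto
      ultimately show False using det' 3 by (simp only: distrib_left mult.commute[of d c])
    qed
    define B :: "int^2^2" where "B = (\<chi> i j. if i = 1 then (if j = 1 then c else d) else (if j = 1 then r else s))"
    have B: "B$1$1 = c" "B$1$2 = d" "B$2$1 = r" "B$2$2 = s" by (simp_all add: B_def)
    have "\<exists>U. (\<forall>k\<in>set U. k > 0) \<and> word_matrix U = B"
    proof (rule less.hyps)
      show "nat (B$2$1) < nat (A$2$1)" using r 3 by (simp add: B flip: defs(3))
      show "\<bar>det B\<bar> = 1" using det' by (simp add: B det_2)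
    qed (use le r s0 sr sd in \<open>simp_all add: B\<close>)
    then obtain U where U: "\<forall>k\<in>set U. k > 0" "word_matrix U = B" by blast
    have "A$1$1 = k * c + r" "A$1$2 = k * d + s" "A$2$1 = c" "A$2$2 = d"
      using a by (simp_all add: s_def flip: defs)
    with k have "word_matrix (nat k # U) = A"
      unfolding matrix_eq_2 by (simp add: U B)
    then show ?thesis using U k by (intro exI[of _ "nat k # U"]) auto
  qed
qed

section \<open>The fixed points of a word matrix\<close>

text \<open>
  The roots \<open>p\<close> and \<open>q\<close> of \<open>c x\<^sup>2 + (d - a) x - b\<close>, given by Vieta's formulas so that no division is
  involved.
\<close>

definition fixpoint_pair :: "int^2^2 \<Rightarrow> real \<Rightarrow> real \<Rightarrow> bool" where
  "fixpoint_pair A p q \<longleftrightarrow>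
     of_int (A$2$1) * (p + q) = of_int (A$1$1) - of_int (A$2$2) \<and>
     of_int (A$2$1) * (p * q) = - of_int (A$1$2)"

lemma fixpoint_pair_sym: "fixpoint_pair A p q \<Longrightarrow> fixpoint_pair A q p"
  by (simp add: fixpoint_pair_def add.commute mult.commute)

lemma fixpoint_pair_denom:
  assumes "fixpoint_pair A p q"
  shows "of_int (A$1$1) - of_int (A$2$1) * q = denom A p"
    and "of_int (A$1$1) * p + of_int (A$1$2) = p * denom A p"
proof -
  have s: "of_int (A$2$1) * (p + q) = of_int (A$1$1) - of_int (A$2$2)"
    and t: "of_int (A$2$1) * (p * q) = - of_int (A$1$2)"
    using assms by (auto simp: fixpoint_pair_def)
  show "of_int (A$1$1) - of_int (A$2$1) * q = denom A p"
    using s by (simp add: algebra_simps)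
  have "p * denom A p - (of_int (A$1$1) * p + of_int (A$1$2)) =
     p * (of_int (A$2$1) * (p + q) - (of_int (A$1$1) - of_int (A$2$2)))
     - (of_int (A$2$1) * (p * q) + of_int (A$1$2))"
    by (simp add: algebra_simps)
  then show "of_int (A$1$1) * p + of_int (A$1$2) = p * denom A p"
    using s t by simp
qed

text \<open>
  The numbers \<open>c p + d\<close> and \<open>c q + d\<close> are the two eigenvalues of \<open>A\<close>.
\<close>

lemma fixpoint_pair_denom_mult:
  assumes "fixpoint_pair A p q" "det A = 1"
  shows "denom A p * denom A q = 1"
proof -
  have s: "of_int (A$2$1) * (p + q) = of_int (A$1$1) - of_int (A$2$2)"
    and t: "of_int (A$2$1) * (p * q) = - of_int (A$1$2)"
    using assms by (auto simp: fixpoint_pair_def)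
  have "denom A p * denom A q = of_int (A$2$1) * (of_int (A$2$1) * (p * q)) +
      of_int (A$2$2) * (of_int (A$2$1) * (p + q)) + of_int (A$2$2) * of_int (A$2$2)"
    by (simp add: algebra_simps)
  also have "\<dots> = of_int (A$1$1) * of_int (A$2$2) - of_int (A$1$2) * of_int (A$2$1)"
    unfolding s t by (simp add: algebra_simps)
  finally show ?thesis using det_2_eq_1[OF assms(2)] by simp
qed

lemma fixpoint_pair_moebius:
  assumes "fixpoint_pair A p q" "det A = 1"
  shows "moebius A p = p"
proof -
  have "denom A p \<noteq> 0" using fixpoint_pair_denom_mult[OF assms] by auto
  then show ?thesis using fixpoint_pair_denom(2)[OF assms(1)] by (simp add: moebius_def)
qed

text \<open>
  With \<open>P(x) = c x\<^sup>2 + (d - a) x - b\<close>, the signs \<open>P(-1) > 0\<close>, \<open>P(0) < 0\<close> and \<open>P(1) < 0\<close> locate the roots.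
  They follow from the monotonicity of the entries along rows and columns.
\<close>

lemma word_fixpoints_exist:
  assumes "even_word W" "W \<noteq> []"
  shows "\<exists>p q. fixpoint_pair (word_matrix W) p q \<and> p > 1 \<and> - 1 < q \<and> q < 0"
proof -
  define A where "A = word_matrix W"
  define a b c d where defs: "a = real_of_int (A$1$1)" "b = real_of_int (A$1$2)"
    "c = real_of_int (A$2$1)" "d = real_of_int (A$2$2)"
  have pos: "\<forall>k\<in>set W. k > 0" using assms(1) by (simp add: even_word_def)
  have le: "1 \<le> d" "d \<le> b" "d \<le> c" "b \<le> a" "c \<le> a"
    using even_word_matrix_pos[OF assms] word_matrix_entries[OF pos assms(2)]
    by (simp_all add: defs A_def)
  have det: "a * d - b * c = 1"
    using det_2_eq_1[OF det_word_matrix_even[OF assms(1)], where ?'a=real] by (simp add: defs A_def)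
  have bc: "b * c > 0" using le by simp
  define D where "D = (a - d)\<^sup>2 + 4 * (b * c)"
  define p q where "p = ((a - d) + sqrt D) / (2 * c)" and "q = ((a - d) - sqrt D) / (2 * c)"
  have D: "D > (a - d)\<^sup>2" using bc by (simp add: D_def)
  have sq: "(sqrt D)\<^sup>2 = D" using bc by (simp add: D_def)
  have sum: "c * (p + q) = a - d" using le by (simp add: p_def q_def field_simps)
  have prod: "c * (p * q) = - b"
  proof -
    have "c * (p * q) = ((a - d)\<^sup>2 - (sqrt D)\<^sup>2) / (4 * c)"
      using le by (simp add: p_def q_def power2_eq_square field_simps)
    also have "\<dots> = - b" using le unfolding sq by (simp add: D_def)
    finally show ?thesis .
  qed
  have "sqrt D > \<bar>a - d\<bar>" using D by (metis real_sqrt_abs real_sqrt_less_mono)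
  then have p0: "p > 0" and q0: "q < 0" using le by (auto simp: p_def q_def field_simps)
  have "a + b \<noteq> c + d"
  proof
    assume "a + b = c + d" then have "a = c" "b = d" using le by auto
    with det show False by simp
  qed
  moreover have "c * ((1 - p) * (1 - q)) = c - c * (p + q) + c * (p * q)"
    by (simp add: algebra_simps)
  ultimately have "c * ((1 - p) * (1 - q)) < 0" using le unfolding sum prod by auto
  then have p1: "p > 1" using le q0 by (auto simp: mult_less_0_iff)
  have "a + c \<noteq> b + d"
  proof
    assume "a + c = b + d" then have "a = b" "c = d" using le by auto
    with det show False by (simp add: mult.commute)
  qed
  moreover have "c * ((1 + p) * (1 + q)) = c + c * (p + q) + c * (p * q)"
    by (simp add: algebra_simps)
  ultimately have "c * ((1 + p) * (1 + q)) > 0" using le unfolding sum prod by auto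
  then have "q > -1" using le p0 by (auto simp: zero_less_mult_iff)
  then show ?thesis using sum prod p1 q0 unfolding fixpoint_pair_def defs A_def by blast
qed

lemma word_denom_gt_1:
  assumes "even_word W" "W \<noteq> []" "x > 0"
  shows "denom (word_matrix W) x \<ge> (1 + x :: real)"
    and "denom (word_matrix W) x > (1::real)"
proof -
  have pos: "\<forall>k\<in>set W. k > 0" using assms(1) by (simp add: even_word_def)
  have "1 \<le> real_of_int (word_matrix W $ 2 $ 2)" "1 \<le> real_of_int (word_matrix W $ 2 $ 1)"
    using even_word_matrix_pos[OF assms(1,2)] word_matrix_entries[OF pos assms(2)] by simp_all
  moreover from this have "1 * x \<le> real_of_int (word_matrix W $ 2 $ 1) * x"
    using assms(3) by (intro mult_right_mono) auto
  ultimately show "denom (word_matrix W) x \<ge> (1 + x :: real)"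
    "denom (word_matrix W) x > 1" using assms(3) by linarith+
qed

text \<open>
  The second bound does not depend on \<open>x\<close>, so that a single application of the word already brings
  the whole half line into a bounded neighbourhood of the fixed point.
\<close>

lemma word_contraction:
  assumes W: "even_word W" "W \<noteq> []" and p: "fixpoint_pair (word_matrix W) p q" "p > 1" and x: "x > 0"
  shows "\<bar>moebius (word_matrix W) x - p\<bar> \<le> \<bar>x - p\<bar> / denom (word_matrix W) p"
    and "\<bar>moebius (word_matrix W) x - p\<bar> \<le> p / denom (word_matrix W) p"
proof -
  let ?A = "word_matrix W"
  have gt: "denom ?A x \<ge> 1 + x" "denom ?A p > 1" 
    using word_denom_gt_1(1)[OF W x] word_denom_gt_1(2)[OF W, of p] p by auto
  have "moebius ?A x - p = (x - p) / (denom ?A x * denom ?A p)"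
    using moebius_diff[of ?A x p] fixpoint_pair_moebius[OF p(1)] det_word_matrix_even[OF W(1)] gt x by simp
  then have eq: "\<bar>moebius ?A x - p\<bar> = (\<bar>x - p\<bar> / denom ?A x) / denom ?A p"
    using gt x by (simp add: abs_mult)
  have "\<bar>x - p\<bar> / denom ?A x \<le> \<bar>x - p\<bar> / 1"
    using gt x by (intro divide_left_mono) auto
  then show "\<bar>moebius ?A x - p\<bar> \<le> \<bar>x - p\<bar> / denom ?A p"
    unfolding eq using gt by (intro divide_right_mono) auto
  have "\<bar>x - p\<bar> \<le> p * (1 + x)"
  proof -
    have "x \<le> p * x" using p x by simp
    moreover have "p * (1 + x) = p + p * x" by (simp add: algebra_simps)
    ultimately show ?thesis using x p by linarith
  qed
  also have "\<dots> \<le> p * denom ?A x" using gt p by (intro mult_left_mono) auto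
  finally have "\<bar>x - p\<bar> / denom ?A x \<le> p" using gt x by (simp add: field_simps)
  then show "\<bar>moebius ?A x - p\<bar> \<le> p / denom ?A p"
    unfolding eq using gt by (intro divide_right_mono) auto
qed

lemma word_power_contraction:
  assumes W: "even_word W" "W \<noteq> []" and p: "fixpoint_pair (word_matrix W) p q" "p > 1" and x: "x > 0"
  shows "\<bar>moebius (word_matrix (word_power W (Suc m))) x - p\<bar> \<le> p / denom (word_matrix W) p ^ Suc m"
proof (induction m)
  case 0
  then show ?case using word_contraction(2)[OF assms] by (simp add: word_power_Suc)
next
  case (Suc m)
  have pos: "\<forall>k\<in>set (word_power W (Suc m)). k > 0" 
    using even_word_power[OF W(1)] unfolding even_word_def by blast
  have "moebius (word_matrix (word_power W (Suc (Suc m)))) x =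
        moebius (word_matrix W) (moebius (word_matrix (word_power W (Suc m))) x)"
    unfolding word_power_Suc[of W "Suc m"] using moebius_word_append[OF pos x] .
  also have "\<bar>\<dots> - p\<bar> \<le> \<bar>moebius (word_matrix (word_power W (Suc m))) x - p\<bar> / denom (word_matrix W) p"
    by (rule word_contraction(1)[OF W p]) (rule moebius_word_pos[OF pos x])
  also have "\<dots> \<le> (p / denom (word_matrix W) p ^ Suc m) / denom (word_matrix W) p"
    using word_denom_gt_1(2)[OF W, of p] p by (intro divide_right_mono Suc) auto
  finally show ?case by (simp add: mult.commute)
qed

section \<open>Purely periodic continued fractions\<close>

lemma finite_cfrac_Cons: "ks \<noteq> [] \<Longrightarrow> finite_cfrac (k # ks) = of_nat k + 1 / finite_cfrac ks"
  by (cases ks) auto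

lemma finite_cfrac_pos: "\<forall>k\<in>set X. k > 0 \<Longrightarrow> X \<noteq> [] \<Longrightarrow> finite_cfrac X > 0"
proof (induction X)
  case (Cons k X)
  then show ?case by (cases "X = []") (auto simp: finite_cfrac_Cons add_pos_pos)
qed simp

text \<open>
  The letters of \<open>U\<close> act on the value of the remaining continued fraction.
\<close>

lemma finite_cfrac_append:
  assumes "\<forall>k\<in>set (U @ X). k > 0" "X \<noteq> []"
  shows "finite_cfrac (U @ X) = moebius (word_matrix U) (finite_cfrac X)"
  using assms(1)
proof (induction U)
  case Nil
  then show ?case by (simp add: word_matrix.simps moebius_mat_1)
next
  case (Cons k U)
  then show ?case
    using assms(2) moebius_word_Cons[OF _ finite_cfrac_pos[OF _ assms(2)], of U k]
    by (simp add: finite_cfrac_Cons)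
qed

lemma periodic_word_prefix:
  assumes "s \<le> length W"
  shows "map (\<lambda>i. W ! (i mod length W)) [0..<m * length W + s] = word_power W m @ take s W"
proof (induction m)
  case 0
  show ?case using assms by (auto intro!: nth_equalityI)
next
  case (Suc m)
  let ?r = "length W"
  have "[0..<Suc m * ?r + s] = [0..<?r] @ [?r..<?r + (m * ?r + s)]"
    by (simp add: add.assoc) (metis upt_add_eq_append zero_le add_0)
  also have "[?r..<?r + (m * ?r + s)] = map (\<lambda>i. i + ?r) [0..<m * ?r + s]"
    by (simp add: map_add_upt add.commute)
  finally have "map (\<lambda>i. W ! (i mod ?r)) [0..<Suc m * ?r + s] =
     map (\<lambda>i. W ! (i mod ?r)) [0..<?r] @ map (\<lambda>i. W ! (i mod ?r)) [0..<m * ?r + s]"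
    by (simp add: o_def)
  also have "map (\<lambda>i. W ! (i mod ?r)) [0..<?r] = W" by (auto intro!: nth_equalityI)
  finally show ?case using Suc by (simp add: word_power_Suc)
qed

text \<open>
  The convergents with at least one full period are \<open>M\<^sub>W\<^sup>m x\<close> with \<open>x > 0\<close> and \<open>m\<close> the number of periods,
  and \<open>M\<^sub>W\<close> contracts towards \<open>p\<close>; this settles the convergence together with the value.
\<close>

lemma periodic_cfrac_eq_fixpoint:
  assumes W: "even_word W" "W \<noteq> []" and p: "fixpoint_pair (word_matrix W) p q" "p > 1"
  shows "periodic_cfrac W = p"
proof -
  let ?r = "length W" and ?e = "denom (word_matrix W) p"
  define F where "F n = finite_cfrac (map (\<lambda>i. W ! (i mod ?r)) [0..<Suc n])" for n
  have r: "?r > 0" using W by simp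
  have e: "?e > 1" using word_denom_gt_1(2)[OF W, of p] p by auto
  have pos: "\<forall>k\<in>set W. k > 0" using W(1) by (simp add: even_word_def)
  have bound: "\<bar>F n - p\<bar> \<le> p / ?e ^ (n div ?r)" if n: "n \<ge> ?r" for n
  proof -
    define m where "m = n div ?r"
    have m: "m > 0" using n r by (simp add: m_def div_greater_zero_iff)
    define X where "X = take (Suc (n mod ?r)) W"
    have X: "X \<noteq> []" "\<forall>k\<in>set X. k > 0" using W pos by (auto simp: X_def dest: in_set_takeD)
    have "Suc n = m * ?r + Suc (n mod ?r)" by (simp add: m_def)
    then have "map (\<lambda>i. W ! (i mod ?r)) [0..<Suc n] = word_power W m @ X"
      using periodic_word_prefix[of "Suc (n mod ?r)" W m] r by (simp only: X_def Suc_le_eq mod_less_divisor)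
    then have "F n = moebius (word_matrix (word_power W m)) (finite_cfrac X)"
      using finite_cfrac_append[of "word_power W m" X] X even_word_power[OF W(1), of m]
      by (auto simp: F_def even_word_def)
    moreover obtain j where "m = Suc j" using m gr0_conv_Suc by auto
    ultimately show ?thesis
      using word_power_contraction[OF W p finite_cfrac_pos[OF X(2,1)], of j] by (simp add: m_def)
  qed
  have "filterlim (\<lambda>n. n div ?r) at_top sequentially"
    unfolding filterlim_at_top
  proof
    fix Z
    have "Z \<le> n div ?r" if "n \<ge> Z * ?r" for n using that r by (simp add: less_eq_div_iff_mult_less_eq)
    then show "\<forall>\<^sub>F n in sequentially. Z \<le> n div ?r" by (auto simp: eventually_sequentially)
  qed
  then have "(\<lambda>n. p * (inverse ?e ^ (n div ?r))) \<longlonglongrightarrow> p * 0"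
    using e by (intro tendsto_intros filterlim_compose[OF LIMSEQ_power_zero]) (auto simp: inverse_less_1_iff)
  then have lim0: "(\<lambda>n. p / ?e ^ (n div ?r)) \<longlonglongrightarrow> 0" by (simp add: field_simps)
  have "\<forall>\<^sub>F n in sequentially. norm (F n - p) \<le> p / ?e ^ (n div ?r)"
    using eventually_ge_at_top[of ?r] by eventually_elim (use bound in simp)
  then have "(\<lambda>n. F n - p) \<longlonglongrightarrow> 0" by (rule Lim_null_comparison[OF _ lim0])
  then have "F \<longlonglongrightarrow> p" by (simp add: LIM_zero_iff)
  then show ?thesis unfolding periodic_cfrac_def infinite_cfrac_def F_def by (rule limI)
qed

text \<open>
  Infinite descent on the denominator: if \<open>n p\<close> is an integer, then so is \<open>(n / e) p\<close>, where
  \<open>e = c p + d > 1\<close> is the eigenvalue, because \<open>A\<inverse>\<close> maps the integral vector \<open>(n p, n)\<close> to \<open>(n p, n) / e\<close>.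
\<close>

lemma hyperbolic_fixpoint_irrational:
  assumes A: "det A = 1" and p: "fixpoint_pair A p q" "denom A p > 1"
  shows "p \<notin> \<rat>"
proof
  assume "p \<in> \<rat>"
  then obtain m :: int and k :: int where "k > 0" "p = of_int m / of_int k"
    by (elim Rats_cases') blast
  then have "real (nat k) * p = of_int m" "nat k > 0" by simp_all
  moreover have "real n * p \<noteq> of_int m" if "n > 0" for n :: nat and m :: int
    using that
  proof (induction n arbitrary: m rule: less_induct)
    case (less n)
    show ?case
    proof
      assume *: "real n * p = of_int m"
      let ?e = "denom A p"
      \<comment> \<open>The vector \<open>(m', n')\<close> is the image of \<open>(m, n)\<close> under the inverse matrix.\<close>
      define n' where "n' = A$1$1 * int n - A$2$1 * m"
      define m' where "m' = A$2$2 * m - A$1$2 * int n"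
      have inv: "?e * (of_int (A$1$1) - of_int (A$2$1) * p) = 1"
        using fixpoint_pair_denom(1)[OF fixpoint_pair_sym[OF p(1)]] fixpoint_pair_denom_mult[OF p(1) A] by simp
      have n': "of_int n' = real n * (of_int (A$1$1) - of_int (A$2$1) * p)"
        using * by (simp add: n'_def algebra_simps)
      have m': "of_int m' = real n * (of_int (A$2$2) * p - of_int (A$1$2))"
        using * by (simp add: m'_def algebra_simps)
      have en': "?e * of_int n' = real n"
        unfolding n' by (subst mult.left_commute) (simp only: inv mult_1_right)
      then have "of_int n' > (0::real)" using less.prems p(2) by (smt (verit) of_nat_0_less_iff zero_less_mult_iff)
      moreover from this have "of_int n' < ?e * of_int n'" using p(2) by simp
      ultimately have lt: "0 < n'" "n' < int n" using en' by linarith+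
      have "?e * (of_int n' * p) = ?e * of_int m'"
      proof -
        have "?e * (of_int (A$2$2) * p - of_int (A$1$2)) = p"
        proof -
          have "?e * (of_int (A$2$2) * p - of_int (A$1$2)) = of_int (A$2$2) * (p * ?e) - of_int (A$1$2) * ?e"
            by (simp add: algebra_simps)
          also have "\<dots> = of_int (A$2$2) * (of_int (A$1$1) * p + of_int (A$1$2)) - of_int (A$1$2) * ?e"
            using fixpoint_pair_denom(2)[OF p(1)] by simp
          also have "\<dots> = (of_int (A$1$1) * of_int (A$2$2) - of_int (A$1$2) * of_int (A$2$1)) * p"
            by (simp add: algebra_simps)
          finally show ?thesis using det_2_eq_1[OF A, where ?'a=real] by simp
        qed
        then have "?e * of_int m' = real n * p" unfolding m' by (subst mult.left_commute) (simp only:)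
        then show ?thesis using en' by (simp add: mult.assoc[symmetric])
      qed
      then have "of_int n' * p = of_int m'" using p(2) by simp
      moreover have "real (nat n') = of_int n'" using lt by simp
      moreover have "nat n' < n" "nat n' > 0" using lt by linarith+
      ultimately show False using less.IH[of "nat n'" m'] by simp
    qed
  qed
  ultimately show False by blast
qed

text \<open>
  Eliminating \<open>w\<^sup>2\<close> leaves a linear relation with integral coefficients, which has to be trivial.
\<close>

lemma irrational_root_proportional:
  fixes \<alpha> \<beta> \<gamma> \<alpha>' \<beta>' \<gamma>' :: int and w :: real
  assumes "w \<notin> \<rat>"
    and 1: "of_int \<alpha> * w\<^sup>2 + of_int \<beta> * w + of_int \<gamma> = 0"
    and 2: "of_int \<alpha>' * w\<^sup>2 + of_int \<beta>' * w + of_int \<gamma>' = 0"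
  shows "\<alpha>' * \<beta> = \<alpha> * \<beta>'" "\<alpha>' * \<gamma> = \<alpha> * \<gamma>'"
proof -
  define u v where "u = \<alpha>' * \<beta> - \<alpha> * \<beta>'" and "v = \<alpha>' * \<gamma> - \<alpha> * \<gamma>'"
  have "of_int u * w + of_int v = of_int \<alpha>' * (of_int \<alpha> * w\<^sup>2 + of_int \<beta> * w + of_int \<gamma>)
     - of_int \<alpha> * (of_int \<alpha>' * w\<^sup>2 + of_int \<beta>' * w + of_int \<gamma>')"
    by (simp add: u_def v_def algebra_simps)
  also have "\<dots> = 0" unfolding 1 2 by simp
  finally have uv: "of_int u * w + of_int v = 0" .
  have "u = 0"
  proof (rule ccontr)
    assume "u \<noteq> 0"
    then have "w = - of_int v / of_int u" using uv by (simp add: field_simps)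
    also have "\<dots> \<in> \<rat>" by simp
    finally show False using assms(1) by simp
  qed
  with uv have "v = 0" by simp
  from \<open>u = 0\<close> \<open>v = 0\<close> show "\<alpha>' * \<beta> = \<alpha> * \<beta>'" "\<alpha>' * \<gamma> = \<alpha> * \<gamma>'"
    by (simp_all add: u_def v_def)
qed

lemma fixpoint_pair_quadratic:
  assumes "fixpoint_pair A p q"
  shows "of_int (A$2$1) * p\<^sup>2 + of_int (A$2$2 - A$1$1) * p + of_int (- (A$1$2)) = 0"
  using fixpoint_pair_denom(2)[OF assms] by (simp add: algebra_simps power2_eq_square)

lemma galois_conj_eq_fixpoint:
  assumes A: "A$2$1 \<noteq> 0" and p: "fixpoint_pair A p q" "p \<notin> \<rat>" "p \<noteq> q"
  shows "galois_conj p = q"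
  unfolding galois_conj_def
proof (rule the_equality, goal_cases)
  case 1
  show ?case
    using fixpoint_pair_quadratic[OF p(1)] fixpoint_pair_quadratic[OF fixpoint_pair_sym[OF p(1)]] A p(3)
    by blast
next
  case (2 x)
  then obtain \<alpha> \<beta> \<gamma> :: int where x: "x \<noteq> p" "\<alpha> \<noteq> 0" and rp: "of_int \<alpha> * p\<^sup>2 + of_int \<beta> * p + of_int \<gamma> = 0"
    and rx: "of_int \<alpha> * x\<^sup>2 + of_int \<beta> * x + of_int \<gamma> = 0" by blast
  have "(p - x) * (of_int \<alpha> * (p + x) + of_int \<beta>) =
     (of_int \<alpha> * p\<^sup>2 + of_int \<beta> * p + of_int \<gamma>) - (of_int \<alpha> * x\<^sup>2 + of_int \<beta> * x + of_int \<gamma>)"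
    by (simp add: algebra_simps power2_eq_square)
  also have "\<dots> = 0" unfolding rp rx by simp
  finally have s: "of_int \<alpha> * (p + x) = - of_int \<beta>" using x by simp
  have "A$2$1 * \<beta> = \<alpha> * (A$2$2 - A$1$1)"
    using irrational_root_proportional(1)[OF p(2) rp fixpoint_pair_quadratic[OF p(1)]] .
  then have "real_of_int (A$2$1) * of_int \<beta> = of_int \<alpha> * of_int (A$2$2 - A$1$1)"
    by (metis of_int_mult)
  moreover have "of_int (A$2$2 - A$1$1) = - (of_int (A$2$1) * (p + q))"
    using p(1) by (simp add: fixpoint_pair_def)
  ultimately have "of_int (A$2$1) * (of_int \<alpha> * (p + x)) = of_int \<alpha> * (of_int (A$2$1) * (p + q))"
    unfolding s by simp
  then show ?case using A x by simp
qed

lemma periodic_cfrac_fixpoints: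
  assumes W: "even_word W" "W \<noteq> []"
  defines "w \<equiv> periodic_cfrac W"
  shows "fixpoint_pair (word_matrix W) w (galois_conj w)"
    and "w > 1" "- 1 < galois_conj w" "galois_conj w < 0" "w \<notin> \<rat>"
proof -
  obtain p q where pq: "fixpoint_pair (word_matrix W) p q" "p > 1" "- 1 < q" "q < 0"
    using word_fixpoints_exist[OF W] by blast
  have w: "w = p" unfolding w_def using periodic_cfrac_eq_fixpoint[OF W pq(1,2)] .
  have e: "denom (word_matrix W) p > 1" using word_denom_gt_1(2)[OF W, of p] pq by simp
  have irr: "p \<notin> \<rat>" using hyperbolic_fixpoint_irrational[OF det_word_matrix_even[OF W(1)] pq(1) e] .
  have pos: "\<forall>k\<in>set W. k > 0" using W(1) by (simp add: even_word_def)
  have "word_matrix W $ 2 $ 1 \<noteq> 0"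
    using even_word_matrix_pos[OF W] word_matrix_entries(3)[OF pos W(2)] by simp
  from galois_conj_eq_fixpoint[OF this pq(1) irr] have "galois_conj w = q" using w pq by simp
  then show "fixpoint_pair (word_matrix W) w (galois_conj w)"
    and "w > 1" "- 1 < galois_conj w" "galois_conj w < 0" "w \<notin> \<rat>"
    using pq w irr by simp_all
qed

section \<open>The inverse action on the interval of conjugates\<close>

text \<open>
  The action of the adjugate matrix, which for determinant \<open>1\<close> is that of the inverse.
\<close>

definition inverse_moebius :: "int^2^2 \<Rightarrow> real \<Rightarrow> real" where
  "inverse_moebius A x = (of_int (A$2$2) * x - of_int (A$1$2)) / (of_int (A$1$1) - of_int (A$2$1) * x)"

text \<open>
  The interval \<open>(-1, 0)\<close> contains the conjugates of all purely periodic continued fractions and is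
  preserved by the inverses of even words; this is what confines the second pole of the
  kernel when a prefix of a word is removed.
\<close>

lemma inverse_moebius_word:
  assumes U: "even_word U" and x: "- 1 < x" "x < 0"
  shows "of_int (word_matrix U $ 1 $ 1) - of_int (word_matrix U $ 2 $ 1) * x \<ge> 1"
    and "denom (word_matrix U) (inverse_moebius (word_matrix U) x) \<noteq> 0"
    and "moebius (word_matrix U) (inverse_moebius (word_matrix U) x) = x"
    and "- 1 < inverse_moebius (word_matrix U) x" "inverse_moebius (word_matrix U) x < 0"
proof -
  define a b c d where defs: "a = real_of_int (word_matrix U$1$1)" "b = real_of_int (word_matrix U$1$2)"
    "c = real_of_int (word_matrix U$2$1)" "d = real_of_int (word_matrix U$2$2)"
  have det: "a * d - b * c = 1"
    using det_2_eq_1[OF det_word_matrix_even[OF U], where ?'a=real] by (simp add: defs)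
  define v where "v = a - c * x"
  have inv: "inverse_moebius (word_matrix U) x = (d * x - b) / v"
    by (simp add: inverse_moebius_def defs v_def)
  have *: "v \<ge> 1 \<and> - v < d * x - b \<and> d * x - b < 0"
  proof (cases "U = []")
    case True
    then show ?thesis using x by (simp add: defs v_def)
  next
    case False
    have pos: "\<forall>k\<in>set U. k > 0" using U by (simp add: even_word_def)
    have le: "1 \<le> d" "d \<le> b" "d \<le> c" "b \<le> a" "c \<le> a"
      using even_word_matrix_pos[OF U False] word_matrix_entries[OF pos False] by (simp_all add: defs)
    have cx: "c * x < 0" using le x by (simp add: mult_pos_neg)
    have dx: "d * x < 0" using le x by (simp add: mult_pos_neg)
    have dc: "c * x \<le> d * x" using le x by (intro mult_right_mono_neg) auto
    have "b < a \<or> c * x < d * x"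
    proof (rule ccontr)
      assume "\<not> ?thesis" then have "b = a" "c * x = d * x" using le dc by auto
      then have "b = a" "c = d" using x by auto
      with det show False by simp
    qed
    with le cx dx dc show ?thesis unfolding v_def by linarith
  qed
  then show "of_int (word_matrix U $ 1 $ 1) - of_int (word_matrix U $ 2 $ 1) * x \<ge> 1"
    "- 1 < inverse_moebius (word_matrix U) x" "inverse_moebius (word_matrix U) x < 0"
    unfolding inv by (simp_all add: v_def defs field_simps)
  have v0: "v \<noteq> 0" using * by auto
  have "denom (word_matrix U) (inverse_moebius (word_matrix U) x) = (c * (d * x - b) + d * v) / v"
    unfolding inv using v0 by (simp add: field_simps flip: defs)
  also have "c * (d * x - b) + d * v = a * d - b * c" by (simp add: v_def algebra_simps)
  finally have den: "denom (word_matrix U) (inverse_moebius (word_matrix U) x) = 1 / v" using det by simp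
  then show "denom (word_matrix U) (inverse_moebius (word_matrix U) x) \<noteq> 0" using v0 by simp
  have "a * ((d * x - b) / v) + b = (a * (d * x - b) + b * v) / v" using v0 by (simp add: field_simps)
  also have "a * (d * x - b) + b * v = (a * d - b * c) * x" by (simp add: v_def algebra_simps)
  finally have "a * ((d * x - b) / v) + b = x / v" using det by simp
  then show "moebius (word_matrix U) (inverse_moebius (word_matrix U) x) = x"
    unfolding moebius_def den using v0 by (simp add: inv flip: defs)
qed

text \<open>
  The conjugate \<open>q\<close> is repelling for \<open>M\<^sub>W\<close>, hence attracting for its inverse.
\<close>

lemma inverse_word_contraction:
  assumes W: "even_word W" "W \<noteq> []"
    and p: "fixpoint_pair (word_matrix W) p q" "- 1 < q" "q < 0" and x: "- 1 < x" "x < 0"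
  shows "\<bar>inverse_moebius (word_matrix W) x - q\<bar> \<le> \<bar>x - q\<bar> / denom (word_matrix W) p"
proof -
  let ?A = "word_matrix W" and ?y = "inverse_moebius (word_matrix W) x"
  define v where "v = of_int (?A$1$1) - of_int (?A$2$1) * x"
  have det: "det ?A = 1" using det_word_matrix_even[OF W(1)] .
  have v: "v \<ge> 1" using inverse_moebius_word(1)[OF W(1) x] by (simp add: v_def)
  have e: "of_int (?A$1$1) - of_int (?A$2$1) * q = denom ?A p"
    using fixpoint_pair_denom(1)[OF p(1)] .
  have e1: "denom ?A p \<ge> 1" using inverse_moebius_word(1)[OF W(1) p(2,3)] unfolding e .
  have q: "of_int (?A$2$2) * q - of_int (?A$1$2) = q * denom ?A p"
  proof -
    have "q * denom ?A p - (of_int (?A$2$2) * q - of_int (?A$1$2)) = of_int (?A$2$1) * (p * q) + of_int (?A$1$2)"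
      by (simp add: algebra_simps)
    then show ?thesis using p(1) by (simp add: fixpoint_pair_def)
  qed
  have "?y - q = (of_int (?A$2$2) * x - of_int (?A$1$2)) / v - (of_int (?A$2$2) * q - of_int (?A$1$2)) / denom ?A p"
    using q e1 by (simp add: inverse_moebius_def v_def)
  also have "\<dots> = ((of_int (?A$2$2) * x - of_int (?A$1$2)) * denom ?A p - (of_int (?A$2$2) * q - of_int (?A$1$2)) * v) / (v * denom ?A p)"
    using v e1 by (subst diff_frac_eq) (auto simp: mult.commute)
  also have "(of_int (?A$2$2) * x - of_int (?A$1$2)) * denom ?A p - (of_int (?A$2$2) * q - of_int (?A$1$2)) * v
     = (of_int (?A$1$1) * of_int (?A$2$2) - of_int (?A$1$2) * of_int (?A$2$1)) * (x - q)"
    unfolding e[symmetric] v_def by (simp add: algebra_simps)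
  finally have "?y - q = (x - q) / (v * denom ?A p)" using det_2_eq_1[OF det, where ?'a=real] by simp
  then have "\<bar>?y - q\<bar> = (\<bar>x - q\<bar> / v) / denom ?A p" using v e1 by (simp add: abs_mult)
  also have "\<dots> \<le> (\<bar>x - q\<bar> / 1) / denom ?A p"
    using v e1 by (intro divide_right_mono divide_left_mono) auto
  finally show ?thesis by simp
qed

section \<open>Stabilizers of quadratic irrationals\<close>

lemma SL2Z_simps [simp]:
  "A \<in> carrier SL2Z \<longleftrightarrow> det A = 1" "A \<otimes>\<^bsub>SL2Z\<^esub> B = A ** B" "\<one>\<^bsub>SL2Z\<^esub> = mat 1"
  by (auto simp: SL2Z_def)

lemma stabilizer_denom:
  assumes "A \<in> SL2Z_stabilizer w" "w \<notin> \<rat>"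
  shows "denom A w \<noteq> 0" "of_int (A$1$1) * w + of_int (A$1$2) = w * denom A w"
proof -
  have w: "moebius A w = w" "w \<noteq> 0" using assms by (auto simp: SL2Z_stabilizer_def)
  then show *: "denom A w \<noteq> 0" by (auto simp: moebius_def)
  show "of_int (A$1$1) * w + of_int (A$1$2) = w * denom A w"
    using w(1) * by (simp add: moebius_def divide_eq_eq)
qed

text \<open>
  An element fixing the irrational number \<open>w\<close> also fixes its conjugate, because both equations have
  proportional coefficients.
\<close>

lemma stabilizer_fixpoint_pair:
  assumes A: "A \<in> SL2Z_stabilizer w" and w: "w \<notin> \<rat>"
    and B: "fixpoint_pair B w q" "B$2$1 \<noteq> 0"
  shows "fixpoint_pair A w q"
proof -
  have rA: "of_int (A$2$1) * w\<^sup>2 + of_int (A$2$2 - A$1$1) * w + of_int (- (A$1$2)) = 0"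
    using stabilizer_denom(2)[OF A w] by (simp add: algebra_simps power2_eq_square)
  note ratio = irrational_root_proportional[OF w rA fixpoint_pair_quadratic[OF B(1)]]
  have s: "of_int (B$2$1) * (w + q) = of_int (B$1$1) - of_int (B$2$2)"
    and t: "of_int (B$2$1) * (w * q) = - of_int (B$1$2)"
    using B(1) by (auto simp: fixpoint_pair_def)
  have "B$2$1 * (A$1$1 - A$2$2) = A$2$1 * (B$1$1 - B$2$2)"
    using ratio(1) by (simp add: algebra_simps)
  from arg_cong[OF this, of real_of_int]
  have "real_of_int (B$2$1) * (of_int (A$1$1) - of_int (A$2$2)) = of_int (A$2$1) * (of_int (B$1$1) - of_int (B$2$2))"
    by (simp only: of_int_mult of_int_diff)
  then have "real_of_int (B$2$1) * (of_int (A$2$1) * (w + q)) = of_int (B$2$1) * (of_int (A$1$1) - of_int (A$2$2))"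
    unfolding s[symmetric] by (simp only: mult.left_commute)
  moreover have "B$2$1 * (- (A$1$2)) = A$2$1 * (- (B$1$2))"
    using ratio(2) by simp
  from arg_cong[OF this, of real_of_int]
  have "real_of_int (B$2$1) * (- of_int (A$1$2)) = of_int (A$2$1) * (- of_int (B$1$2))"
    by (simp only: of_int_mult of_int_minus)
  then have "real_of_int (B$2$1) * (of_int (A$2$1) * (w * q)) = of_int (B$2$1) * (- of_int (A$1$2))"
    unfolding t[symmetric] by (simp only: mult.left_commute)
  ultimately show ?thesis
    using B(2) unfolding fixpoint_pair_def mult_cancel_left of_int_eq_0_iff by blast
qed

lemma stabilizer_denom_mult:
  assumes "B \<in> SL2Z_stabilizer w" "w \<notin> \<rat>"
  shows "denom (A ** B) w = denom A w * denom B w"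
proof -
  have "denom (A ** B) w = of_int (A$2$1) * (of_int (B$1$1) * w + of_int (B$1$2)) + of_int (A$2$2) * denom B w"
    by (simp add: matrix_matrix_mult_def sum_2 algebra_simps)
  also have "\<dots> = denom A w * denom B w"
    unfolding stabilizer_denom(2)[OF assms] by (simp add: algebra_simps)
  finally show ?thesis .
qed

lemma stabilizer_mult:
  assumes "A \<in> SL2Z_stabilizer w" "B \<in> SL2Z_stabilizer w" "w \<notin> \<rat>"
  shows "A ** B \<in> SL2Z_stabilizer w"
  using assms moebius_mult[of B w A] stabilizer_denom(1)[OF assms(2,3)]
  by (simp add: SL2Z_stabilizer_def det_mul)

lemma irrational_affine_eq:
  fixes a b a' b' :: int and w :: real
  assumes "w \<notin> \<rat>" "of_int a * w + of_int b = of_int a' * w + of_int b'"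
  shows "a = a'" "b = b'"
proof -
  have *: "of_int (a - a') * w = of_int (b' - b)" using assms(2) by (simp add: algebra_simps)
  show "a = a'"
  proof (rule ccontr)
    assume "a \<noteq> a'"
    then have "w = of_int (b' - b) / of_int (a - a')" using * by (simp add: field_simps)
    also have "\<dots> \<in> \<rat>" by (intro Rats_divide) simp_all
    finally show False using assms(1) by simp
  qed
  with assms(2) show "b = b'" by simp
qed

text \<open>
  The eigenvalue \<open>c w + d\<close> is an injective character of the stabilizer. This replaces
  computations with matrices by computations with real numbers; in particular the stabilizer is
  commutative.
\<close>

lemma stabilizer_eqI:
  assumes "A \<in> SL2Z_stabilizer w" "B \<in> SL2Z_stabilizer w" "w \<notin> \<rat>" "denom A w = denom B w"
  shows "A = B"
proof -
  have "of_int (A$1$1) * w + of_int (A$1$2) = of_int (B$1$1) * w + of_int (B$1$2)"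
    using stabilizer_denom(2)[OF assms(1,3)] stabilizer_denom(2)[OF assms(2,3)] assms(4) by simp
  then show ?thesis
    using irrational_affine_eq[OF assms(3)] assms(4) unfolding matrix_eq_2 by blast
qed

text \<open>
  Let \<open>e = c w + d > 1\<close>. The conjugate eigenvalue is \<open>1 / e\<close>, and with \<open>r = - c w'\<close> the entries are
  \<open>a = c w + 1 / e\<close>, \<open>b = w r\<close> and \<open>d = r + 1 / e\<close>, where \<open>0 < r < c\<close>. Together with \<open>w > 1\<close> this yields the
  inequalities needed for the Euclidean algorithm; those that involve \<open>d\<close> hold only up to an error
  \<open>1 / e < 1\<close>, which integrality removes.
\<close>

lemma stabilizer_word:
  assumes A: "A \<in> SL2Z_stabilizer w" and w: "w \<notin> \<rat>" "w > 1" and q: "-1 < q" "q < 0"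
    and pair: "fixpoint_pair A w q" and gt: "denom A w > 1"
  shows "\<exists>U. even_word U \<and> word_matrix U = A"
proof -
  define a b c d where defs: "a = real_of_int (A$1$1)" "b = real_of_int (A$1$2)"
    "c = real_of_int (A$2$1)" "d = real_of_int (A$2$2)"
  have det: "det A = 1" using A by (simp add: SL2Z_stabilizer_def)
  have s: "c * (w + q) = a - d" and t: "c * (w * q) = - b"
    using pair by (simp_all add: fixpoint_pair_def defs)
  define e where "e = c * w + d"
  have e: "e > 1" using gt by (simp add: e_def defs)
  have "e * (c * q + d) = 1"
    using fixpoint_pair_denom_mult[OF pair det] by (simp add: e_def defs)
  then have inv: "c * q + d = 1 / e" using e by (simp add: field_simps)
  have inv1: "1 / e > 0" "1 / e < 1" using e by auto
  have "c * (w - q) = e - (c * q + d)" by (simp add: e_def algebra_simps)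
  then have "c * (w - q) > 0" using e inv1 unfolding inv by linarith
  then have c: "c > 0" using w(2) q by (simp add: zero_less_mult_iff)
  define r where "r = - (c * q)"
  have r: "0 < r" "r < c" using c q by (auto simp: r_def mult_pos_neg)
     (metis (no_types) add.inverse_inverse c minus_less_iff mult.right_neutral mult_less_cancel_left_pos mult_minus_right)
  have d: "d = 1 / e + r" using inv by (simp add: r_def)
  have b: "b = w * r" using t by (simp add: r_def algebra_simps)
  have a: "a = c * w + 1 / e" using s inv by (simp add: algebra_simps)
  have cw: "c * w > c" using c w(2) by simp
  have wr: "w * r > r" using w(2) r by simp
  have "w * r < c * w" using r w(2) by (simp add: mult.commute)
  then have ab: "b < a" unfolding a b using inv1 by linarith
  have ac: "c < a" using a cw inv1 by linarith
  have "d < c + 1" using d r inv1 by linarith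
  then have "A$2$2 < A$2$1 + 1" unfolding defs by linarith
  moreover have "d < b + 1" using d b wr inv1 by linarith
  then have "A$2$2 < A$1$2 + 1" unfolding defs by linarith
  moreover have "0 < d" using d r inv1 by linarith
  ultimately have "\<exists>U. (\<forall>k\<in>set U. k > 0) \<and> word_matrix U = A"
    using ab ac det by (intro euclid_word) (auto simp: defs)
  then obtain U where U: "\<forall>k\<in>set U. k > 0" "word_matrix U = A" by blast
  have "(-1 :: int) ^ length U = 1" using U det det_word_matrix[of U] by simp
  then have "even (length U)" by (metis one_neq_neg_one neg_one_odd_power)
  then show ?thesis using U by (auto simp: even_word_def)
qed

text \<open>
  The set whose maximum defines the exponent is finite and contains \<open>1\<close>; for a maximal exponent the
  root \<open>W1\<close> is primitive among even words.
\<close>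

lemma word_exponent_decompose:
  assumes W: "even_word W" "W \<noteq> []"
  obtains W1 where "even_word W1" "W = word_power W1 (word_exponent W)" "word_exponent W > 0" "W1 \<noteq> []"
    "\<And>Z n. even_word Z \<Longrightarrow> n > 0 \<Longrightarrow> W1 = word_power Z n \<Longrightarrow> n = 1"
proof -
  define S where "S = {n. n > 0 \<and> (\<exists>W1. even_word W1 \<and> W = word_power W1 n)}"
  have le: "n \<le> length W" if "n \<in> S" for n
  proof -
    from that obtain W1 where W1: "W = word_power W1 n" by (auto simp: S_def)
    with W(2) have "W1 \<noteq> []" by (auto simp: word_power_def)
    then have "length W1 \<ge> 1" by (simp add: Suc_le_eq)
    then show ?thesis using W1 by (simp add: length_word_power)
  qed
  then have "S \<subseteq> {..length W}" by auto
  then have fin: "finite S" by (rule finite_subset) simp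
  have "W = word_power W 1" by (simp add: word_power_def)
  with W(1) have "1 \<in> S" unfolding S_def by blast
  then have N: "Max S \<in> S" using fin by (intro Max_in) auto
  have ex: "word_exponent W = Max S" by (simp add: word_exponent_def S_def)
  from N obtain W1 where W1: "even_word W1" "W = word_power W1 (Max S)" "Max S > 0"
    by (auto simp: S_def)
  have prim: "n = 1" if Z: "even_word Z" "n > 0" "W1 = word_power Z n" for Z n
  proof -
    have "W = word_power Z (n * Max S)" using W1(2) Z(3) by (simp add: word_power_mult)
    then have "n * Max S \<in> S" using Z W1(3) by (auto simp: S_def)
    then have "n * Max S \<le> Max S" using fin by simp
    then show ?thesis using W1(3) Z(2) by simp
  qed
  have "W1 \<noteq> []" using W1(2) W(2) by (auto simp: word_power_def)
  with W1 prim show ?thesis using that[of W1] ex by simp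
qed

text \<open>
  Commuting words are powers of a common word \<open>Z\<close>. If \<open>Z\<close> has odd length, both exponents are even and
  \<open>Z Z\<close> serves instead.
\<close>

lemma commuting_even_words:
  assumes U: "even_word U" and X: "even_word X" "X \<noteq> []" and comm: "U @ X = X @ U"
  shows "\<exists>Z m n. even_word Z \<and> n > 0 \<and> U = word_power Z m \<and> X = word_power Z n"
proof -
  obtain m n Z where Z: "U = word_power Z m" "X = word_power Z n"
    using comm_append_are_replicate[OF comm] unfolding word_power_def by metis
  have n: "n > 0" using Z(2) X(2) by (cases n) auto
  have "set Z \<subseteq> set X" using n by (cases n) (auto simp: Z(2) word_power_Suc)
  then have pos: "\<forall>k\<in>set Z. k > 0" using X(1) by (auto simp: even_word_def)
  show ?thesis
  proof (cases "even (length Z)")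
    case True
    then show ?thesis using Z n pos by (auto simp: even_word_def)
  next
    case False
    have "even (length U)" "even (length X)" using U X by (simp_all add: even_word_def)
    then have "even m" "even n" using Z False by (simp_all add: length_word_power)
    then obtain m' n' where mn: "m = 2 * m'" "n = 2 * n'" by (auto elim!: evenE)
    have ev: "even_word (Z @ Z)" using pos by (auto simp: even_word_def)
    have "word_power Z 2 = Z @ Z" by (simp add: word_power_def numeral_2_eq_2)
    then have "U = word_power (Z @ Z) m'" "X = word_power (Z @ Z) n'"
      using Z mn by (simp_all flip: word_power_mult)
    then show ?thesis using ev n mn by (intro exI[of _ "Z @ Z"] exI[of _ m'] exI[of _ n']) simp
  qed
qed

lemma word_matrix_pow:
  "word_matrix W [^]\<^bsub>SL2Z\<^esub> (n::nat) = word_matrix (word_power W n)"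
proof (induction n)
  case 0
  then show ?case by (simp add: nat_pow_def SL2Z_def word_matrix.simps)
next
  case (Suc n)
  have "word_power W (Suc n) = word_power W n @ W"
    using word_power_add[of W n 1] by (simp add: word_power_def)
  then show ?case using Suc by (simp add: word_matrix_append nat_pow_def SL2Z_def)
qed

lemma SL2Z_inv:
  assumes "det A = 1"
  shows "det (inv\<^bsub>SL2Z\<^esub> A) = 1" "A ** inv\<^bsub>SL2Z\<^esub> A = mat 1" "inv\<^bsub>SL2Z\<^esub> A ** A = mat 1"
proof -
  interpret group SL2Z by (rule group_SL2Z)
  have A: "A \<in> carrier SL2Z" using assms by simp
  from inv_closed[OF A] r_inv[OF A] l_inv[OF A]
  show "det (inv\<^bsub>SL2Z\<^esub> A) = 1" "A ** inv\<^bsub>SL2Z\<^esub> A = mat 1" "inv\<^bsub>SL2Z\<^esub> A ** A = mat 1" by simp_all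
qed

lemma stabilizer_one: "mat 1 \<in> SL2Z_stabilizer w"
  by (simp add: SL2Z_stabilizer_def moebius_mat_1)

lemma stabilizer_inv:
  assumes "A \<in> SL2Z_stabilizer w" "w \<notin> \<rat>"
  shows "inv\<^bsub>SL2Z\<^esub> A \<in> SL2Z_stabilizer w" "denom (inv\<^bsub>SL2Z\<^esub> A) w = 1 / denom A w"
proof -
  let ?B = "inv\<^bsub>SL2Z\<^esub> A"
  have det: "det A = 1" using assms by (simp add: SL2Z_stabilizer_def)
  have "moebius (?B ** A) w = moebius ?B (moebius A w)"
    by (rule moebius_mult) (rule stabilizer_denom(1)[OF assms])
  then show "?B \<in> SL2Z_stabilizer w"
    using assms(1) SL2Z_inv[OF det] by (simp add: SL2Z_stabilizer_def moebius_mat_1)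
  have "denom ?B w * denom A w = denom (?B ** A) w" using stabilizer_denom_mult[OF assms, of ?B] by simp
  also have "\<dots> = 1" using SL2Z_inv[OF det] by (simp add: mat_def)
  finally show "denom ?B w = 1 / denom A w" using stabilizer_denom(1)[OF assms] by (simp add: field_simps)
qed

lemma stabilizer_uminus:
  assumes "A \<in> SL2Z_stabilizer w"
  shows "- A \<in> SL2Z_stabilizer w"
proof -
  have "moebius (- A) w = moebius A w"
  proof -
    have "moebius (- A) w = (- (of_int (A$1$1) * w + of_int (A$1$2))) / (- denom A w)"
      by (simp add: moebius_def)
    then show ?thesis by (simp only: minus_divide_divide moebius_def)
  qed
  then show ?thesis using assms by (simp add: SL2Z_stabilizer_def det_2)
qed

lemma periodic_cfrac_power:
  assumes "W \<noteq> []" "n > 0"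
  shows "periodic_cfrac (word_power W n) = periodic_cfrac W"
proof -
  let ?U = "word_power W n"
  have len: "length ?U = n * length W" by (simp add: length_word_power)
  have nth: "?U ! (i mod length ?U) = W ! (i mod length W)" for i
  proof -
    have l: "i mod length ?U < n * length W" using assms by (simp add: len)
    have "?U = map (\<lambda>i. W ! (i mod length W)) [0..<n * length W]"
      using periodic_word_prefix[of 0 W n] by simp
    then have "?U ! (i mod length ?U) = map (\<lambda>i. W ! (i mod length W)) [0..<n * length W] ! (i mod length ?U)"
      by simp
    also have "\<dots> = W ! ((i mod length ?U) mod length W)" using l by simp
    also have "(i mod length ?U) mod length W = i mod length W"
      unfolding len by (rule mod_mod_cancel) simp
    finally show ?thesis .
  qed
  show ?thesis unfolding periodic_cfrac_def nth ..
qed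

text \<open>
  An element of the stabilizer with eigenvalue greater than \<open>1\<close> is a word matrix \<open>M\<^sub>U\<close> that commutes with
  the matrix of \<open>W1\<close>. So \<open>U\<close> and \<open>W1\<close> commute, and \<open>U\<close> is a power of \<open>W1\<close> as \<open>W1\<close> is primitive. Signs and
  inverses reduce every other element to this case.
\<close>

lemma fund_stabilizer_word:
  assumes W: "even_word W" "W \<noteq> []"
    and W1: "even_word W1" "W = word_power W1 N" "W1 \<noteq> []" "N > 0"
    and prim: "\<And>Z n. even_word Z \<Longrightarrow> n > 0 \<Longrightarrow> W1 = word_power Z n \<Longrightarrow> n = 1"
  shows "fund_stabilizer (periodic_cfrac W) = word_matrix W1"
proof -
  interpret group SL2Z by (rule group_SL2Z)
  define w q M where "w = periodic_cfrac W" and "q = galois_conj w" and "M = word_matrix W1"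
  have w: "w > 1" "-1 < q" "q < 0" "w \<notin> \<rat>" and pairW: "fixpoint_pair (word_matrix W) w q"
    using periodic_cfrac_fixpoints[OF W] by (simp_all add: w_def q_def)
  have posW: "\<forall>k\<in>set W. k > 0" using W(1) by (simp add: even_word_def)
  have W21: "word_matrix W $ 2 $ 1 \<noteq> 0"
    using even_word_matrix_pos[OF W] word_matrix_entries(3)[OF posW W(2)] by simp
  have detM: "det M = 1" using det_word_matrix_even[OF W1(1)] by (simp add: M_def)
  have "periodic_cfrac W1 = w"
    unfolding w_def using periodic_cfrac_power[OF W1(3,4)] W1(2) by simp
  then have pairM: "fixpoint_pair M w q"
    using periodic_cfrac_fixpoints(1)[OF W1(1,3)] by (simp add: M_def q_def)
  have Mstab: "M \<in> SL2Z_stabilizer w"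
    using fixpoint_pair_moebius[OF pairM detM] detM by (simp add: SL2Z_stabilizer_def)
  have Mgt: "denom M w > 1" using word_denom_gt_1(2)[OF W1(1,3), of w] w by (simp add: M_def)
  have pow: "M [^]\<^bsub>SL2Z\<^esub> (n::nat) = word_matrix (word_power W1 n)" for n
    by (simp add: M_def word_matrix_pow)
  have big: "\<exists>m::nat. A = M [^]\<^bsub>SL2Z\<^esub> m" if A: "A \<in> SL2Z_stabilizer w" "denom A w > 1" for A
  proof -
    obtain U where U: "even_word U" "word_matrix U = A"
      using stabilizer_word[OF A(1) w(4,1,2,3) stabilizer_fixpoint_pair[OF A(1) w(4) pairW W21] A(2)] by blast
    have "denom (A ** M) w = denom (M ** A) w"
      unfolding stabilizer_denom_mult[OF A(1) w(4)] stabilizer_denom_mult[OF Mstab w(4)]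
      by (rule mult.commute)
    then have "A ** M = M ** A"
      using stabilizer_mult[OF A(1) Mstab w(4)] stabilizer_mult[OF Mstab A(1) w(4)] w(4)
      by (intro stabilizer_eqI)
    then have "word_matrix (U @ W1) = word_matrix (W1 @ U)" by (simp add: word_matrix_append U M_def)
    then have "U @ W1 = W1 @ U"
      using U(1) W1(1) by (intro word_matrix_inj) (auto simp: even_word_def)
    from commuting_even_words[OF U(1) W1(1,3) this]
    obtain Z m n where Z: "even_word Z" "n > 0" "U = word_power Z m" "W1 = word_power Z n" by blast
    from prim[OF Z(1,2,4)] Z have "W1 = Z" by (simp add: word_power_def)
    with Z U pow have "A = M [^]\<^bsub>SL2Z\<^esub> m" by simp
    then show ?thesis ..
  qed
  have powstab: "A [^]\<^bsub>SL2Z\<^esub> (n::nat) \<in> SL2Z_stabilizer w \<and> denom (A [^]\<^bsub>SL2Z\<^esub> n) w = denom A w ^ n"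
    if "A \<in> SL2Z_stabilizer w" for A n
  proof (induction n)
    case 0
    show ?case using stabilizer_one by (simp add: mat_def)
  next
    case (Suc n)
    then show ?case using stabilizer_mult[OF _ that w(4)] stabilizer_denom_mult[OF that w(4)]
      by (simp add: mult.commute)
  qed
  have gen: "SL2Z_stabilizer w = (\<Union>n::int. {M [^]\<^bsub>SL2Z\<^esub> n, - (M [^]\<^bsub>SL2Z\<^esub> n)})" (is "_ = ?G")
  proof (intro equalityI subsetI)
    fix A assume "A \<in> ?G"
    then obtain n :: int where n: "A = M [^]\<^bsub>SL2Z\<^esub> n \<or> A = - (M [^]\<^bsub>SL2Z\<^esub> n)" by auto
    have "M [^]\<^bsub>SL2Z\<^esub> n \<in> SL2Z_stabilizer w"
      using powstab[OF Mstab] stabilizer_inv(1)[OF _ w(4)]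
      by (cases n rule: int_cases2) (simp_all add: int_pow_int int_pow_neg_int detM)
    with n stabilizer_uminus show "A \<in> SL2Z_stabilizer w" by auto
  next
    fix A assume A: "A \<in> SL2Z_stabilizer w"
    have pos: "\<exists>n::int. B = M [^]\<^bsub>SL2Z\<^esub> n" if B: "B \<in> SL2Z_stabilizer w" "denom B w > 0" for B
    proof -
      consider "denom B w > 1" | "denom B w = 1" | "denom B w < 1" by linarith
      then show ?thesis
      proof cases
        case 1
        from big[OF B(1) this] show ?thesis by (metis int_pow_int)
      next
        case 2
        then have "B = mat 1" using B(1) w(4) stabilizer_one
          by (intro stabilizer_eqI[of B w]) (auto simp: mat_def)
        then have "B = M [^]\<^bsub>SL2Z\<^esub> (0::int)" by simp
        then show ?thesis ..
      next
        case 3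
        then have "denom (inv\<^bsub>SL2Z\<^esub> B) w > 1" using B stabilizer_inv(2)[OF B(1) w(4)] by simp
        from big[OF stabilizer_inv(1)[OF B(1) w(4)] this]
        obtain m :: nat where m: "inv\<^bsub>SL2Z\<^esub> B = M [^]\<^bsub>SL2Z\<^esub> m" by blast
        have "B \<in> carrier SL2Z" using B by (simp add: SL2Z_stabilizer_def)
        then have "B = inv\<^bsub>SL2Z\<^esub> (inv\<^bsub>SL2Z\<^esub> B)" by simp
        then have "B = M [^]\<^bsub>SL2Z\<^esub> (- int m)" using m detM by (simp add: int_pow_neg_int)
        then show ?thesis ..
      qed
    qed
    show "A \<in> ?G"
    proof (cases "denom A w > 0")
      case True
      with pos[OF A] show ?thesis by auto
    next
      case False
      then have "denom (- A) w > 0" using stabilizer_denom(1)[OF A w(4)] by simp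
      from pos[OF stabilizer_uminus[OF A] this] obtain n :: int where "- A = M [^]\<^bsub>SL2Z\<^esub> n" by blast
      then have "A = - (M [^]\<^bsub>SL2Z\<^esub> n)" by (metis minus_minus)
      then show ?thesis by auto
    qed
  qed
  show ?thesis unfolding fund_stabilizer_def w_def[symmetric] M_def[symmetric]
  proof (rule the_equality)
    show "M \<in> SL2Z_stabilizer w \<and> SL2Z_stabilizer w = (\<Union>n::int. {M [^]\<^bsub>SL2Z\<^esub> n, - (M [^]\<^bsub>SL2Z\<^esub> n)}) \<and>
      denom M w > 1"
      using Mstab gen Mgt by blast
  next
    fix B
    assume B: "B \<in> SL2Z_stabilizer w \<and> SL2Z_stabilizer w = (\<Union>n::int. {B [^]\<^bsub>SL2Z\<^esub> n, - (B [^]\<^bsub>SL2Z\<^esub> n)}) \<and>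
      denom B w > 1"
    then have Bs: "B \<in> SL2Z_stabilizer w" and Bgt: "denom B w > 1" by auto
    from B Mstab have "M \<in> (\<Union>n::int. {B [^]\<^bsub>SL2Z\<^esub> n, - (B [^]\<^bsub>SL2Z\<^esub> n)})" by metis
    then obtain n :: int where n: "M = B [^]\<^bsub>SL2Z\<^esub> n \<or> M = - (B [^]\<^bsub>SL2Z\<^esub> n)" by auto
    have Bcar: "B \<in> carrier SL2Z" using Bs by (simp add: SL2Z_stabilizer_def)
    have pos: "denom (B [^]\<^bsub>SL2Z\<^esub> n) w > 0" and small: "n < 0 \<Longrightarrow> denom (B [^]\<^bsub>SL2Z\<^esub> n) w \<le> 1"
      using powstab[OF Bs] stabilizer_inv(2)[OF _ w(4)] Bgt Bcar
      by (cases n rule: int_cases2; simp add: int_pow_int int_pow_neg_int)+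
    have Mn: "M = B [^]\<^bsub>SL2Z\<^esub> n"
    proof (rule ccontr)
      assume "M \<noteq> B [^]\<^bsub>SL2Z\<^esub> n"
      with n have "denom M w = - denom (B [^]\<^bsub>SL2Z\<^esub> n) w" by auto
      with pos Mgt show False by simp
    qed
    have "n \<ge> 0" using small Mn Mgt by force
    then obtain j where j: "n = int j" by (metis nonneg_int_cases)
    obtain m where m: "B = M [^]\<^bsub>SL2Z\<^esub> (m::nat)" using big[OF Bs Bgt] by blast
    have "M = M [^]\<^bsub>SL2Z\<^esub> (m * j)" using Mn j m detM by (simp add: int_pow_int nat_pow_pow)
    then have "word_matrix W1 = word_matrix (word_power W1 (m * j))" using pow by (simp add: M_def)
    then have "W1 = word_power W1 (m * j)"
      using W1(1) even_word_power[OF W1(1), of "m * j"] by (intro word_matrix_inj) (simp_all add: even_word_def)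
    then have "length W1 = m * j * length W1" by (metis length_word_power)
    then have "m = 1" using W1(3) by simp
    then show "B = M" using m detM by simp
  qed
qed

section \<open>Integrals between points of the upper half plane\<close>

text \<open>
  For \<open>p = w\<close> and \<open>q = w'\<close> the integrand is \<open>f \<eta>\<^sub>w\<close>. The two poles are independent parameters here,
  since the comparison of a long word with its blocks moves them separately.
\<close>

definition segment_integral :: "(complex \<Rightarrow> complex) \<Rightarrow> real \<Rightarrow> real \<Rightarrow> complex \<Rightarrow> complex \<Rightarrow> complex" where
  "segment_integral f p q z1 z2 = contour_integral (linepath z1 z2)
     (\<lambda>z. f z * (1 / (z - of_real q) - 1 / (z - of_real p)))"

lemma upper_half_plane_topology: "convex upper_half_plane" "open upper_half_plane"
  unfolding upper_half_plane_def using convex_halfspace_Im_gt open_halfspace_Im_gt by auto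

lemma upper_half_plane_not_real: "z \<in> upper_half_plane \<Longrightarrow> z - of_real x \<noteq> 0"
  by (auto simp: upper_half_plane_def)

lemma kernel_holomorphic:
  assumes "f holomorphic_on upper_half_plane"
  shows "(\<lambda>z. f z * (1 / (z - of_real q) - 1 / (z - of_real p))) holomorphic_on upper_half_plane"
  using assms upper_half_plane_not_real by (intro holomorphic_intros) auto

lemma kernel_primitive:
  assumes "f holomorphic_on upper_half_plane"
  obtains F where "\<And>z. z \<in> upper_half_plane \<Longrightarrow>
     (F has_field_derivative f z * (1 / (z - of_real q) - 1 / (z - of_real p))) (at z)"
proof -
  obtain F where F: "\<And>z. z \<in> upper_half_plane \<Longrightarrow>
     (F has_field_derivative f z * (1 / (z - of_real q) - 1 / (z - of_real p))) (at z within upper_half_plane)"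
    using holomorphic_convex_primitive'[OF upper_half_plane_topology kernel_holomorphic[OF assms]] by metis
  show ?thesis
  proof (rule that)
    fix z assume z: "z \<in> upper_half_plane"
    show "(F has_field_derivative f z * (1 / (z - of_real q) - 1 / (z - of_real p))) (at z)"
      using F[OF z] at_within_open[OF z upper_half_plane_topology(2)] by simp
  qed
qed

lemma path_integral_primitive:
  assumes F: "\<And>z. z \<in> upper_half_plane \<Longrightarrow> (F has_field_derivative h z) (at z)"
    and g: "valid_path g" "path_image g \<subseteq> upper_half_plane"
  shows "(h has_contour_integral (F (pathfinish g) - F (pathstart g))) g"
  using contour_integral_primitive[of upper_half_plane F h g] F g
  by (auto intro: has_field_derivative_at_within)

lemma segment_subset:
  "z1 \<in> upper_half_plane \<Longrightarrow> z2 \<in> upper_half_plane \<Longrightarrow> closed_segment z1 z2 \<subseteq> upper_half_plane"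
  by (simp add: closed_segment_subset upper_half_plane_topology)

lemma segment_integral_primitive:
  assumes F: "\<And>z. z \<in> upper_half_plane \<Longrightarrow>
      (F has_field_derivative f z * (1 / (z - of_real q) - 1 / (z - of_real p))) (at z)"
    and z: "z1 \<in> upper_half_plane" "z2 \<in> upper_half_plane"
  shows "segment_integral f p q z1 z2 = F z2 - F z1"
proof -
  have "((\<lambda>z. f z * (1 / (z - of_real q) - 1 / (z - of_real p))) has_contour_integral
     (F (pathfinish (linepath z1 z2)) - F (pathstart (linepath z1 z2)))) (linepath z1 z2)"
    using segment_subset[OF z] by (intro path_integral_primitive[OF F]) auto
  then show ?thesis by (simp add: segment_integral_def contour_integral_unique)
qed

lemma segment_integral_add:
  assumes f: "f holomorphic_on upper_half_plane"
    and z: "z1 \<in> upper_half_plane" "z2 \<in> upper_half_plane" "z3 \<in> upper_half_plane"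
  shows "segment_integral f p q z1 z2 + segment_integral f p q z2 z3 = segment_integral f p q z1 z3"
proof -
  obtain F where F: "\<And>z. z \<in> upper_half_plane \<Longrightarrow>
     (F has_field_derivative f z * (1 / (z - of_real q) - 1 / (z - of_real p))) (at z)"
    using kernel_primitive[OF f] by metis
  show ?thesis by (simp add: segment_integral_primitive[OF F] z)
qed

lemma moebius_has_derivative:
  assumes A: "det A = 1" and z: "z \<in> upper_half_plane"
  shows "(moebius A has_field_derivative 1 / (denom A z)\<^sup>2) (at (z::complex))"
proof -
  let ?a = "of_int (A$1$1) :: complex" and ?b = "of_int (A$1$2) :: complex"
    and ?c = "of_int (A$2$1) :: complex" and ?d = "of_int (A$2$2) :: complex"
  have nz: "?c * z + ?d \<noteq> 0" using moebius_denominator_nonzero[OF A z] .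
  have "((\<lambda>z. (?a * z + ?b) / (?c * z + ?d)) has_field_derivative
     (?a * (?c * z + ?d) - (?a * z + ?b) * ?c) / ((?c * z + ?d) * (?c * z + ?d))) (at z)"
    using nz by (auto intro!: derivative_eq_intros)
  moreover have "?a * (?c * z + ?d) - (?a * z + ?b) * ?c = ?a * ?d - ?b * ?c"
    by (simp add: algebra_simps)
  ultimately show ?thesis
    using det_2_eq_1[OF A, where ?'a=complex]
    by (simp add: moebius_def[abs_def] power2_eq_square)
qed

text \<open>
  The correction term does not involve \<open>x\<close>, so it cancels in the difference of two such kernels:
  that difference is an invariant differential.
\<close>

lemma kernel_transform:
  fixes x :: real
  assumes A: "det A = 1" and z: "z \<in> upper_half_plane" and x: "denom A x \<noteq> 0"
  shows "1 / (moebius A z - of_real (moebius A x)) * (1 / (denom A z)\<^sup>2) =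
     1 / (z - of_real x) - of_int (A$2$1) / denom A z"
proof -
  have nz: "denom A z \<noteq> 0" using moebius_denominator_nonzero[OF A z] .
  have nx: "denom A (of_real x :: complex) \<noteq> 0"
  proof -
    have "denom A (of_real x :: complex) = of_real (denom A x)" by simp
    then show ?thesis using x by (simp only: of_real_eq_0_iff) simp
  qed
  have d: "moebius A z - of_real (moebius A x) = (z - of_real x) / (denom A z * denom A (of_real x))"
    using moebius_diff[OF A nz nx] by (simp add: moebius_of_real)
  have zx: "z - of_real x \<noteq> 0" using upper_half_plane_not_real[OF z] .
  have "1 / (moebius A z - of_real (moebius A x)) * (1 / (denom A z)\<^sup>2) =
     denom A (of_real x) / ((z - of_real x) * denom A z)"
    unfolding d using nz by (simp add: power2_eq_square)
  also have "denom A (of_real x) = denom A z - of_int (A$2$1) * (z - of_real x)"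
    by (simp add: algebra_simps)
  also have "(denom A z - of_int (A$2$1) * (z - of_real x)) / ((z - of_real x) * denom A z) =
     1 / (z - of_real x) - of_int (A$2$1) / denom A z"
    using nz zx by (simp add: diff_divide_distrib)
  finally show ?thesis .
qed

text \<open>
  If \<open>F\<close> is a primitive for the poles \<open>A p\<close> and \<open>A q\<close>, then \<open>F \<circ> A\<close> is one for \<open>p\<close> and \<open>q\<close>.
\<close>

lemma segment_integral_moebius:
  assumes f: "f holomorphic_on upper_half_plane"
    and inv: "\<And>z. z \<in> upper_half_plane \<Longrightarrow> f (moebius A z) = f z"
    and A: "det A = 1" and x: "denom A p \<noteq> 0" "denom A q \<noteq> 0"
    and z: "z1 \<in> upper_half_plane" "z2 \<in> upper_half_plane"
  shows "segment_integral f (moebius A p) (moebius A q) (moebius A z1) (moebius A z2) =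
         segment_integral f p q z1 z2"
proof -
  obtain F where F: "\<And>z. z \<in> upper_half_plane \<Longrightarrow>
     (F has_field_derivative f z * (1 / (z - of_real (moebius A q)) - 1 / (z - of_real (moebius A p)))) (at z)"
    using kernel_primitive[OF f] by metis
  have "((\<lambda>z. F (moebius A z)) has_field_derivative f z * (1 / (z - of_real q) - 1 / (z - of_real p))) (at z)"
    if z: "z \<in> upper_half_plane" for z
  proof -
    have "((\<lambda>z. F (moebius A z)) has_field_derivative
        f (moebius A z) * (1 / (moebius A z - of_real (moebius A q)) - 1 / (moebius A z - of_real (moebius A p)))
        * (1 / (denom A z)\<^sup>2)) (at z)"
      by (rule DERIV_chain2[OF F[OF moebius_upper_half_plane[OF A z]] moebius_has_derivative[OF A z]])
    also have "f (moebius A z) * (1 / (moebius A z - of_real (moebius A q)) - 1 / (moebius A z - of_real (moebius A p)))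
        * (1 / (denom A z)\<^sup>2) = f z * (1 / (moebius A z - of_real (moebius A q)) * (1 / (denom A z)\<^sup>2)
        - 1 / (moebius A z - of_real (moebius A p)) * (1 / (denom A z)\<^sup>2))"
      unfolding inv[OF z] by (simp only: left_diff_distrib mult.assoc)
    also have "\<dots> = f z * (1 / (z - of_real q) - 1 / (z - of_real p))"
      unfolding kernel_transform[OF A z x(1)] kernel_transform[OF A z x(2)] by simp
    finally show ?thesis .
  qed
  from segment_integral_primitive[OF this z]
  show ?thesis
    by (simp add: segment_integral_primitive[OF F] moebius_upper_half_plane A z)
qed

text \<open>
  On the segment, \<open>|f|\<close> is bounded and \<open>Im z\<close> has a positive minimum \<open>m\<close>; thus \<open>1 / (z - x)\<close> is bounded by
  \<open>1 / m\<close> and has Lipschitz constant \<open>1 / m\<^sup>2\<close> in the real parameter \<open>x\<close>.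
\<close>

lemma segment_integral_bounds:
  assumes f: "f holomorphic_on upper_half_plane"
    and z: "z1 \<in> upper_half_plane" "z2 \<in> upper_half_plane"
  shows "\<exists>K\<ge>0. (\<forall>p q. norm (segment_integral f p q z1 z2) \<le> K) \<and>
    (\<forall>p q p' q'. norm (segment_integral f p q z1 z2 - segment_integral f p' q' z1 z2)
        \<le> K * (\<bar>p - p'\<bar> + \<bar>q - q'\<bar>))"
proof -
  let ?S = "closed_segment z1 z2"
  have S: "?S \<subseteq> upper_half_plane" using segment_subset[OF z] .
  have "compact (f ` ?S)"
    using holomorphic_on_imp_continuous_on[OF holomorphic_on_subset[OF f S]]
    by (intro compact_continuous_image) auto
  then obtain B where B: "\<And>z. z \<in> ?S \<Longrightarrow> norm (f z) \<le> B"
    using compact_imp_bounded bounded_iff by (metis imageI)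
  have B0: "B \<ge> 0" using B[of z1] by (meson ends_in_segment(1) norm_ge_zero order_trans)
  obtain y where y: "y \<in> ?S" "\<And>z. z \<in> ?S \<Longrightarrow> Im y \<le> Im z"
    using continuous_attains_inf[of ?S Im] linear_continuous_on[OF bounded_linear_Im]
    by (metis compact_segment ends_in_segment(1) empty_iff)
  define m where "m = Im y"
  have m: "m > 0" using S y(1) by (auto simp: m_def upper_half_plane_def)
  have far: "norm (z - of_real x) \<ge> m" if "z \<in> ?S" for z x
    using y(2)[OF that] abs_Im_le_cmod[of "z - of_real x"] by (simp add: m_def)
  have nz: "z - of_real x \<noteq> 0" if "z \<in> ?S" for z x
    using S that upper_half_plane_not_real by blast
  have inv: "norm (1 / (z - of_real x)) \<le> 1 / m" if "z \<in> ?S" for z x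
    using far[OF that] m by (simp add: norm_divide frac_le)
  have inv_diff: "norm (1 / (z - of_real x) - 1 / (z - of_real x')) \<le> \<bar>x - x'\<bar> * (1 / m)\<^sup>2" if zS: "z \<in> ?S" for z x x'
  proof -
    have "1 / (z - of_real x) - 1 / (z - of_real x') =
       of_real (x - x') * (1 / (z - of_real x) * (1 / (z - of_real x')))"
      using nz[OF zS] by (simp add: field_simps)
    also have "norm \<dots> = \<bar>x - x'\<bar> * (norm (1 / (z - of_real x)) * norm (1 / (z - of_real x')))"
      by (simp only: norm_mult norm_of_real)
    also have "\<dots> \<le> \<bar>x - x'\<bar> * (1 / m * (1 / m))"
      using inv[OF zS] m by (intro mult_left_mono mult_mono) auto
    finally show ?thesis by (simp add: power2_eq_square)
  qed
  define l where "l = norm (z2 - z1)"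
  define K1 K2 where "K1 = B * (2 / m) * l" and "K2 = B * (1 / m)\<^sup>2 * l"
  have K: "K1 \<ge> 0" "K2 \<ge> 0" using B0 m by (auto simp: K1_def K2_def l_def)
  let ?h = "\<lambda>p q z. f z * (1 / (z - of_real q) - 1 / (z - of_real p))"
  have int: "?h p q contour_integrable_on (linepath z1 z2)" for p q
    using holomorphic_on_imp_continuous_on[OF holomorphic_on_subset[OF kernel_holomorphic[OF f] S]]
    by (rule contour_integrable_continuous_linepath)
  have b1: "norm (segment_integral f p q z1 z2) \<le> K1" for p q
    unfolding segment_integral_def K1_def l_def
  proof (rule contour_integral_bound_linepath[OF int])
    fix z assume zS: "z \<in> ?S"
    have "norm (1 / (z - of_real q) - 1 / (z - of_real p)) \<le> 1 / m + 1 / m"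
      using norm_triangle_ineq4 inv[OF zS] by (meson add_mono order_trans)
    then show "norm (?h p q z) \<le> B * (2 / m)"
      unfolding norm_mult using B[OF zS] B0 by (intro mult_mono) auto
  qed (use B0 m in simp)
  have b2: "norm (segment_integral f p q z1 z2 - segment_integral f p' q' z1 z2)
        \<le> K2 * (\<bar>p - p'\<bar> + \<bar>q - q'\<bar>)" for p q p' q'
  proof -
    have "segment_integral f p q z1 z2 - segment_integral f p' q' z1 z2 =
        contour_integral (linepath z1 z2) (\<lambda>z. ?h p q z - ?h p' q' z)"
      unfolding segment_integral_def by (rule contour_integral_diff[symmetric]) (rule int)+
    also have "norm \<dots> \<le> (B * ((\<bar>p - p'\<bar> + \<bar>q - q'\<bar>) * (1 / m)\<^sup>2)) * norm (z2 - z1)"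
    proof (rule contour_integral_bound_linepath)
      show "(\<lambda>z. ?h p q z - ?h p' q' z) contour_integrable_on linepath z1 z2"
        by (intro contour_integrable_diff int)
    next
      fix z assume zS: "z \<in> ?S"
      have "?h p q z - ?h p' q' z = f z * ((1 / (z - of_real q) - 1 / (z - of_real q')) - (1 / (z - of_real p) - 1 / (z - of_real p')))"
        by (simp add: algebra_simps)
      moreover have "norm ((1 / (z - of_real q) - 1 / (z - of_real q')) - (1 / (z - of_real p) - 1 / (z - of_real p')))
         \<le> \<bar>q - q'\<bar> * (1 / m)\<^sup>2 + \<bar>p - p'\<bar> * (1 / m)\<^sup>2"
        using norm_triangle_ineq4 inv_diff[OF zS] by (meson add_mono order_trans)
      ultimately show "norm (?h p q z - ?h p' q' z) \<le> B * ((\<bar>p - p'\<bar> + \<bar>q - q'\<bar>) * (1 / m)\<^sup>2)"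
        using B[OF zS] B0 by (simp only: norm_mult) (intro mult_mono, auto simp: algebra_simps)
    qed (use B0 in simp)
    finally show ?thesis by (simp add: K2_def l_def mult_ac)
  qed
  show ?thesis
  proof (intro exI[of _ "K1 + K2"] conjI allI)
    show "K1 + K2 \<ge> 0" using K by simp
    show "norm (segment_integral f p q z1 z2) \<le> K1 + K2" for p q
      using b1[of p q] K by simp
    show "norm (segment_integral f p q z1 z2 - segment_integral f p' q' z1 z2)
        \<le> (K1 + K2) * (\<bar>p - p'\<bar> + \<bar>q - q'\<bar>)" for p q p' q'
    proof -
      have "K2 * (\<bar>p - p'\<bar> + \<bar>q - q'\<bar>) \<le> (K1 + K2) * (\<bar>p - p'\<bar> + \<bar>q - q'\<bar>)"
        using K by (intro mult_right_mono) auto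
      then show ?thesis using b2[of p q p' q'] by linarith
    qed
  qed
qed

text \<open>
  The real part of the primitive \<open>Ln (z - q) - Ln (z - p)\<close> is the logarithm of \<open>|z - q| / |z - p|\<close>, and
  \<open>A\<close> multiplies this quotient by \<open>(c p + d) / (c q + d) = (c p + d)\<^sup>2\<close>.
\<close>

lemma Re_segment_integral_one:
  assumes A: "det A = 1" and pair: "fixpoint_pair A p q" and e: "denom A p > 0" and z: "z \<in> upper_half_plane"
  shows "Re (segment_integral (\<lambda>_. 1) p q z (moebius A z)) = 2 * ln (denom A p)"
proof -
  define F where "F z = Ln (z - of_real q) - Ln (z - of_real p)" for z
  have nonpos: "z - of_real x \<notin> \<real>\<^sub>\<le>\<^sub>0" if "z \<in> upper_half_plane" for z x
    using that by (auto simp: complex_nonpos_Reals_iff upper_half_plane_def)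
  have F: "(F has_field_derivative 1 * (1 / (z - of_real q) - 1 / (z - of_real p))) (at z)"
    if "z \<in> upper_half_plane" for z
    unfolding F_def using nonpos[OF that] upper_half_plane_not_real[OF that]
    by (auto intro!: derivative_eq_intros simp: field_simps)
  let ?z' = "moebius A z"
  have z': "?z' \<in> upper_half_plane" using moebius_upper_half_plane[OF A z] .
  have ReF: "Re (F z) = ln (norm (z - of_real q)) - ln (norm (z - of_real p))" if "z \<in> upper_half_plane" for z
    using upper_half_plane_not_real[OF that] by (simp add: F_def)
  have nz: "denom A z \<noteq> 0" using moebius_denominator_nonzero[OF A z] .
  have quot: "ln (norm (?z' - of_real x)) = ln (norm (z - of_real x)) - ln (norm (denom A z)) - ln \<bar>denom A x\<bar>"
    if x: "moebius A x = x" "denom A x \<noteq> 0" for x :: real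
  proof -
    have cx: "denom A (of_real x :: complex) = of_real (denom A x)" by simp
    then have nx: "denom A (of_real x :: complex) \<noteq> 0" using x(2) by (simp only: of_real_eq_0_iff) simp
    have "?z' - of_real x = (z - of_real x) / (denom A z * denom A (of_real x))"
      using moebius_diff[OF A nz nx] by (simp add: moebius_of_real x(1))
    then have "norm (?z' - of_real x) = norm (z - of_real x) / (norm (denom A z) * \<bar>denom A x\<bar>)"
      unfolding cx by (simp only: norm_divide norm_mult norm_of_real)
    then show ?thesis using nz x(2) upper_half_plane_not_real[OF z]
      by (simp add: ln_div ln_mult)
  qed
  have pq: "denom A p * denom A q = 1" using fixpoint_pair_denom_mult[OF pair A] .
  then have q0: "denom A q \<noteq> 0" by auto
  from pq have q: "denom A q = 1 / denom A p" using e by (simp add: field_simps)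
  have "segment_integral (\<lambda>_. 1) p q z ?z' = F ?z' - F z"
    by (rule segment_integral_primitive[OF F z z'])
  then have "Re (segment_integral (\<lambda>_. 1) p q z ?z') = Re (F ?z') - Re (F z)" by simp
  also have "\<dots> = ln \<bar>denom A p\<bar> - ln \<bar>denom A q\<bar>"
    unfolding ReF[OF z] ReF[OF z']
    using quot[OF fixpoint_pair_moebius[OF pair A]] quot[OF fixpoint_pair_moebius[OF fixpoint_pair_sym[OF pair] A]] e pq q0
    by simp
  also have "\<dots> = 2 * ln (denom A p)" unfolding q using e by (simp add: ln_div)
  finally show ?thesis .
qed

section \<open>Integrals attached to words\<close>

definition word_integral :: "(complex \<Rightarrow> complex) \<Rightarrow> real \<Rightarrow> real \<Rightarrow> nat list \<Rightarrow> complex" where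
  "word_integral f p q U = segment_integral f p q \<i> (moebius (word_matrix U) \<i>)"

definition holomorphic_SL2Z_invariant :: "(complex \<Rightarrow> complex) \<Rightarrow> bool" where
  "holomorphic_SL2Z_invariant f \<longleftrightarrow> f holomorphic_on upper_half_plane \<and>
     (\<forall>A z. det A = 1 \<longrightarrow> z \<in> upper_half_plane \<longrightarrow> f (moebius A z) = f z)"

lemma ii_upper: "\<i> \<in> upper_half_plane"
  by (simp add: upper_half_plane_def)

lemma word_ii_upper: "even_word U \<Longrightarrow> moebius (word_matrix U) \<i> \<in> upper_half_plane"
  by (rule moebius_upper_half_plane[OF det_word_matrix_even ii_upper])

lemma invariant_holomorphic: "holomorphic_SL2Z_invariant f \<Longrightarrow> f holomorphic_on upper_half_plane"
  by (simp add: holomorphic_SL2Z_invariant_def)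

lemma segment_integral_invariant:
  assumes f: "holomorphic_SL2Z_invariant f" and A: "det A = 1" and x: "denom A p \<noteq> 0" "denom A q \<noteq> 0"
    and z: "z1 \<in> upper_half_plane" "z2 \<in> upper_half_plane"
  shows "segment_integral f (moebius A p) (moebius A q) (moebius A z1) (moebius A z2) =
         segment_integral f p q z1 z2"
  using f by (intro segment_integral_moebius[OF _ _ A x z]) (auto simp: holomorphic_SL2Z_invariant_def A)

text \<open>
  The path to \<open>M\<^sub>X M\<^sub>Y \<i>\<close> is cut at \<open>M\<^sub>X \<i>\<close>, and the second part is translated back by \<open>M\<^sub>X\<close>. The first
  pole is written as \<open>M\<^sub>X p\<close> to make its translate explicit.
\<close>

lemma word_integral_append:
  assumes f: "holomorphic_SL2Z_invariant f" and X: "even_word X" and Y: "even_word Y"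
    and p: "p > 0" and q: "- 1 < q" "q < 0"
  shows "word_integral f (moebius (word_matrix X) p) q (X @ Y) =
     word_integral f (moebius (word_matrix X) p) q X +
     word_integral f p (inverse_moebius (word_matrix X) q) Y"
proof -
  let ?A = "word_matrix X" and ?z = "moebius (word_matrix Y) \<i>"
  have A: "det ?A = 1" using det_word_matrix_even[OF X] .
  have z: "?z \<in> upper_half_plane" using word_ii_upper[OF Y] .
  have "moebius (word_matrix (X @ Y)) \<i> = moebius ?A ?z"
    unfolding word_matrix_append
    by (rule moebius_mult) (rule moebius_denominator_nonzero[OF det_word_matrix_even[OF Y] ii_upper])
  then have "word_integral f (moebius ?A p) q (X @ Y) =
    word_integral f (moebius ?A p) q X + segment_integral f (moebius ?A p) q (moebius ?A \<i>) (moebius ?A ?z)"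
    unfolding word_integral_def
    using segment_integral_add[of f \<i> "moebius ?A \<i>" "moebius ?A ?z"] f
      ii_upper moebius_upper_half_plane[OF A] z by (simp add: holomorphic_SL2Z_invariant_def)
  also have "segment_integral f (moebius ?A p) q (moebius ?A \<i>) (moebius ?A ?z) =
     segment_integral f p (inverse_moebius ?A q) \<i> ?z"
    using segment_integral_invariant[OF f A _ inverse_moebius_word(2)[OF X q] ii_upper z, of p]
      word_matrix_denominator_pos(1)[OF even_word_pos[OF X] p] inverse_moebius_word(3)[OF X q] by simp
  finally show ?thesis by (simp add: word_integral_def)
qed

lemma word_integral_Nil: "word_integral f p q [] = 0"
  by (simp add: word_integral_def segment_integral_def word_matrix.simps moebius_mat_1)

lemma word_power_integral:
  assumes f: "holomorphic_SL2Z_invariant f" and W: "even_word W" "W \<noteq> []"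
    and pair: "fixpoint_pair (word_matrix W) p q" "p > 0" "- 1 < q" "q < 0"
  shows "word_integral f p q (word_power W n) = of_nat n * word_integral f p q W"
proof (induction n)
  case 0
  show ?case by (simp add: word_integral_Nil)
next
  case (Suc n)
  have "moebius (word_matrix W) p = p" using fixpoint_pair_moebius[OF pair(1) det_word_matrix_even[OF W(1)]] .
  moreover have "inverse_moebius (word_matrix W) q = q"
    using inverse_word_contraction[OF W pair(1,3,4,3,4)] by simp
  ultimately show ?case
    using word_integral_append[OF f W(1) even_word_power[OF W(1), of n] pair(2,3,4)] Suc
    by (simp add: word_power_Suc algebra_simps)
qed

text \<open>
  The fundamental stabilizer is the matrix of the primitive root \<open>W1\<close> of \<open>W\<close>. Since it leaves the
  kernel invariant, the increment of a primitive from \<open>z\<close> to its image does not depend on \<open>z\<close>, which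
  shows that the cycle integral is well defined, and the \<open>N(W)\<close> increments along the powers of \<open>W1\<close> are equal.
\<close>

lemma cycle_integral_word:
  assumes f: "holomorphic_SL2Z_invariant f" and W: "even_word W" "W \<noteq> []"
  defines "w \<equiv> periodic_cfrac W"
  shows "of_nat (word_exponent W) * cycle_integral f w = word_integral f w (galois_conj w) W"
proof -
  obtain W1 where W1: "even_word W1" "W = word_power W1 (word_exponent W)" "word_exponent W > 0" "W1 \<noteq> []"
    "\<And>Z n. even_word Z \<Longrightarrow> n > 0 \<Longrightarrow> W1 = word_power Z n \<Longrightarrow> n = 1"
    using word_exponent_decompose[OF W] by blast
  define q where "q = galois_conj w"
  let ?A = "word_matrix W1"
  have A: "det ?A = 1" using det_word_matrix_even[OF W1(1)] .
  have fund: "fund_stabilizer w = ?A"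
    unfolding w_def by (rule fund_stabilizer_word[OF W W1(1,2,4,3)]) (rule W1(5))
  have per: "periodic_cfrac W1 = w"
    unfolding w_def using periodic_cfrac_power[OF W1(4,3)] W1(2) by simp
  have pair: "fixpoint_pair ?A w q" "w > 1" "-1 < q" "q < 0"
    using periodic_cfrac_fixpoints[OF W1(1,4)] unfolding per q_def by auto
  have nz: "denom ?A w \<noteq> 0" "denom ?A q \<noteq> 0" using fixpoint_pair_denom_mult[OF pair(1) A] by auto
  have fixed: "moebius ?A w = w" "moebius ?A q = q"
    using fixpoint_pair_moebius[OF pair(1) A] fixpoint_pair_moebius[OF fixpoint_pair_sym[OF pair(1)] A] by auto
  have hol: "f holomorphic_on upper_half_plane" using f by (simp add: holomorphic_SL2Z_invariant_def)
  obtain F where F: "\<And>z. z \<in> upper_half_plane \<Longrightarrow>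
     (F has_field_derivative f z * (1 / (z - of_real q) - 1 / (z - of_real w))) (at z)"
    using kernel_primitive[OF hol] by metis
  have const: "F (moebius ?A z) - F z = word_integral f w q W1" if z: "z \<in> upper_half_plane" for z
  proof -
    have z': "moebius ?A z \<in> upper_half_plane" "moebius ?A \<i> \<in> upper_half_plane"
      using moebius_upper_half_plane[OF A] z ii_upper by auto
    have "F (moebius ?A z) - F (moebius ?A \<i>) = segment_integral f w q (moebius ?A \<i>) (moebius ?A z)"
      by (rule segment_integral_primitive[OF F z'(2,1), symmetric])
    also have "\<dots> = segment_integral f w q \<i> z"
      using segment_integral_invariant[OF f A nz ii_upper z] unfolding fixed .
    also have "\<dots> = F z - F \<i>" by (rule segment_integral_primitive[OF F ii_upper z])
    finally have "F (moebius ?A z) - F z = F (moebius ?A \<i>) - F \<i>" by (simp add: algebra_simps)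
    also have "\<dots> = word_integral f w q W1"
      unfolding word_integral_def by (rule segment_integral_primitive[OF F ii_upper z'(2), symmetric])
    finally show ?thesis .
  qed
  have "cycle_integral f w = word_integral f w q W1"
    unfolding cycle_integral_def fund
  proof (rule the_equality, intro allI impI)
    fix z0 g
    assume g: "z0 \<in> upper_half_plane \<and> valid_path g \<and> path_image g \<subseteq> upper_half_plane \<and>
      pathstart g = z0 \<and> pathfinish g = moebius ?A z0"
    show "((\<lambda>z. f z * eta w z) has_contour_integral word_integral f w q W1) g"
      using path_integral_primitive[OF F, of g] g const[of z0] unfolding eta_def q_def by simp
  next
    fix I
    assume I: "\<forall>z0 g. z0 \<in> upper_half_plane \<and> valid_path g \<and> path_image g \<subseteq> upper_half_plane \<and>
      pathstart g = z0 \<and> pathfinish g = moebius ?A z0 \<longrightarrow> ((\<lambda>z. f z * eta w z) has_contour_integral I) g"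
    let ?g = "linepath \<i> (moebius ?A \<i>)"
    have "((\<lambda>z. f z * eta w z) has_contour_integral I) ?g"
      using I segment_subset[OF ii_upper moebius_upper_half_plane[OF A ii_upper]] ii_upper by simp
    then show "I = word_integral f w q W1"
      unfolding eta_def by (simp add: word_integral_def segment_integral_def q_def contour_integral_unique)
  qed
  moreover have "word_integral f w q W = of_nat (word_exponent W) * word_integral f w q W1"
    using word_power_integral[OF f W1(1,4) pair(1) _ pair(3,4), of "word_exponent W"] pair(2) W1(2) by simp
  ultimately show ?thesis by (simp add: q_def)
qed

section \<open>Comparison of a composite word with its blocks\<close>

text \<open>
  The bound is uniform in \<open>n\<close>. The term for the first copy of \<open>W\<close> has its poles at the distances
  at most \<open>w r\<^sup>n\<close> and \<open>|y - q|\<close> from \<open>w\<close> and \<open>q\<close>, where \<open>r < 1\<close> and \<open>n\<close> is the number of copies; removing it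
  shortens \<open>n\<close> by one and multiplies \<open>|y - q|\<close> by at most \<open>r\<close>. So both errors are summed by geometric
  series.
\<close>

lemma word_power_integral_estimate:
  assumes f: "holomorphic_SL2Z_invariant f" and W: "even_word W" "W \<noteq> []"
    and pair: "fixpoint_pair (word_matrix W) w q" "w > 1" "- 1 < q" "q < 0"
  shows "\<exists>K. \<forall>n x y. x > 0 \<longrightarrow> - 1 < y \<longrightarrow> y < 0 \<longrightarrow>
    norm (word_integral f (moebius (word_matrix (word_power W n)) x) y (word_power W n)
       - of_nat n * word_integral f w q W) \<le> K"
proof -
  define r where "r = 1 / denom (word_matrix W) w"
  have e: "denom (word_matrix W) w > 1" using word_denom_gt_1(2)[OF W, of w] pair by simp
  then have r: "0 < r" "r < 1" by (auto simp: r_def)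
  \<comment> \<open>The sum of the geometric series, used through its fixed point equation.\<close>
  define T where "T = 1 / (1 - r)"
  have T: "T > 0" "T = 1 + r * T" using r by (auto simp: T_def field_simps)
  obtain K where K: "K \<ge> 0" "\<And>p q p' q'. norm (segment_integral f p q \<i> (moebius (word_matrix W) \<i>)
      - segment_integral f p' q' \<i> (moebius (word_matrix W) \<i>)) \<le> K * (\<bar>p - p'\<bar> + \<bar>q - q'\<bar>)"
    using segment_integral_bounds[OF invariant_holomorphic[OF f] ii_upper word_ii_upper[OF W(1)]]
    by blast
  have main: "norm (word_integral f (moebius (word_matrix (word_power W n)) x) y (word_power W n)
       - of_nat n * word_integral f w q W) \<le> K * (w * (\<Sum>j<n. r ^ Suc j)) + K * (\<bar>y - q\<bar> * T)"
    if "x > 0" "- 1 < y" "y < 0" for n x y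
    using that
  proof (induction n arbitrary: y)
    case 0
    then show ?case using K(1) T(1) by (simp add: word_integral_Nil)
  next
    case (Suc n)
    let ?P = "word_power W n" and ?I = "word_integral f w q W"
    have P: "even_word ?P" using even_word_power[OF W(1)] .
    define p0 where "p0 = moebius (word_matrix ?P) x"
    have p0: "p0 > 0" unfolding p0_def using moebius_word_pos[OF even_word_pos[OF P] Suc.prems(1)] .
    define p1 where "p1 = moebius (word_matrix W) p0"
    have p1: "moebius (word_matrix (word_power W (Suc n))) x = p1"
      unfolding word_power_Suc p1_def p0_def by (rule moebius_word_append[OF even_word_pos[OF P] Suc.prems(1)])
    define y1 where "y1 = inverse_moebius (word_matrix W) y"
    have y1: "- 1 < y1" "y1 < 0" using inverse_moebius_word(4,5)[OF W(1) Suc.prems(2,3)] by (simp_all add: y1_def)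
    have y1q: "\<bar>y1 - q\<bar> \<le> r * \<bar>y - q\<bar>"
      using inverse_word_contraction[OF W pair(1,3,4) Suc.prems(2,3)] by (simp add: y1_def r_def)
    have p1w: "\<bar>p1 - w\<bar> \<le> w * r ^ Suc n"
      using word_power_contraction[OF W pair(1,2) Suc.prems(1), of n] unfolding p1
      by (simp add: r_def power_divide)
    have "word_integral f p1 y (word_power W (Suc n)) = word_integral f p1 y W + word_integral f p0 y1 ?P"
      unfolding word_power_Suc p1_def y1_def by (rule word_integral_append[OF f W(1) P p0 Suc.prems(2,3)])
    then have split: "word_integral f p1 y (word_power W (Suc n)) - of_nat (Suc n) * ?I =
      (word_integral f p1 y W - ?I) + (word_integral f p0 y1 ?P - of_nat n * ?I)"
      by (simp add: algebra_simps)
    have "norm (word_integral f p1 y W - ?I) \<le> K * (\<bar>p1 - w\<bar> + \<bar>y - q\<bar>)"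
      unfolding word_integral_def by (rule K(2))
    also have "\<dots> \<le> K * (w * r ^ Suc n + \<bar>y - q\<bar>)"
      using p1w K(1) by (intro mult_left_mono) auto
    finally have b1: "norm (word_integral f p1 y W - ?I) \<le> K * (w * r ^ Suc n + \<bar>y - q\<bar>)" .
    have "norm (word_integral f p0 y1 ?P - of_nat n * ?I) \<le>
        K * (w * (\<Sum>j<n. r ^ Suc j)) + K * (\<bar>y1 - q\<bar> * T)"
      using Suc.IH[OF Suc.prems(1) y1] by (simp add: p0_def)
    also have "\<dots> \<le> K * (w * (\<Sum>j<n. r ^ Suc j)) + K * ((r * \<bar>y - q\<bar>) * T)"
      using y1q K(1) T(1) by (intro add_left_mono mult_left_mono mult_right_mono) auto
    finally have b2: "norm (word_integral f p0 y1 ?P - of_nat n * ?I) \<le>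
      K * (w * (\<Sum>j<n. r ^ Suc j)) + K * ((r * \<bar>y - q\<bar>) * T)" .
    have "K * (w * r ^ Suc n + \<bar>y - q\<bar>) + (K * (w * (\<Sum>j<n. r ^ Suc j)) + K * ((r * \<bar>y - q\<bar>) * T))
      = K * (w * (\<Sum>j<Suc n. r ^ Suc j)) + K * (\<bar>y - q\<bar> * (1 + r * T))"
      by (simp only: sum.lessThan_Suc distrib_left distrib_right mult_1_left mult_ac add_ac)
    with norm_triangle_mono[OF b1 b2] show ?case unfolding p1 split T(2)[symmetric] by linarith
  qed
  show ?thesis
  proof (intro exI[of _ "K * (w * T) + K * T"] allI impI)
    fix n and x y :: real assume xy: "x > 0" "- 1 < y" "y < 0"
    have "(\<Sum>j<n. r ^ Suc j) = r * (\<Sum>j<n. r ^ j)" by (simp add: sum_distrib_left)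
    also have "\<dots> = r * ((1 - r ^ n) * T)"
      using r by (simp add: T_def sum_gp_strict)
    also have "\<dots> \<le> 1 * (1 * T)" using r T(1) by (intro mult_mono mult_nonneg_nonneg) (auto simp: power_le_one)
    finally have "K * (w * (\<Sum>j<n. r ^ Suc j)) \<le> K * (w * T)"
      using K(1) pair(2) by (intro mult_left_mono) auto
    moreover have "K * (\<bar>y - q\<bar> * T) \<le> K * (1 * T)"
      using xy pair K(1) T(1) by (intro mult_left_mono mult_right_mono) auto
    ultimately show "norm (word_integral f (moebius (word_matrix (word_power W n)) x) y (word_power W n)
       - of_nat n * word_integral f w q W) \<le> K * (w * T) + K * T"
      using main[OF xy, of n] by simp
  qed
qed

lemma word_integral_bounded:
  assumes f: "holomorphic_SL2Z_invariant f" and V: "even_word V"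
  shows "\<exists>K. \<forall>p q. norm (word_integral f p q V) \<le> K"
  using segment_integral_bounds[OF invariant_holomorphic[OF f] ii_upper word_ii_upper[OF V]]
  unfolding word_integral_def by blast

lemma composite_word_Suc:
  "composite_word (Suc k) V W a = composite_word k V W a @ (word_power (W (Suc k)) (a (Suc k)) @ V (Suc k))"
  by (simp add: composite_word_def)

lemma even_composite_word:
  assumes "\<And>i. i \<in> {0..k} \<Longrightarrow> even_word (V i)" "\<And>i. i \<in> {1..k} \<Longrightarrow> even_word (W i)"
  shows "even_word (composite_word k V W a)"
  using assms
proof (induction k)
  case 0
  then show ?case by (simp add: composite_word_def)
next
  case (Suc k)
  then show ?case unfolding composite_word_Suc
    by (intro even_word_append even_word_power) auto
qed

lemma composite_word_not_Nil:
  assumes "\<And>i. i \<in> {1..k} \<Longrightarrow> W i \<noteq> []" "(\<Sum>i=1..k. real (a i)) > 0"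
  shows "composite_word k V W a \<noteq> []"
proof
  assume Nil: "composite_word k V W a = []"
  have "a i = 0" if i: "i \<in> {1..k}" for i
  proof (rule ccontr)
    assume "a i \<noteq> 0"
    then have "word_power (W i) (a i) \<noteq> []" using assms(1)[OF i] by (cases "a i") (auto simp: word_power_Suc)
    with i Nil show False by (auto simp: composite_word_def)
  qed
  then have "(\<Sum>i=1..k. real (a i)) = 0" by simp
  with assms(2) show False by simp
qed

text \<open>
  Here \<open>x\<close> and \<open>y\<close> are arbitrary, since the induction on \<open>k\<close> removes blocks from the right and thereby
  replaces \<open>x\<close> by its image under the removed part.
\<close>

lemma composite_word_integral_estimate:
  assumes f: "holomorphic_SL2Z_invariant f"
    and "\<And>i. i \<in> {0..k} \<Longrightarrow> even_word (V i)"
    and "\<And>i. i \<in> {1..k} \<Longrightarrow> even_word (W i) \<and> W i \<noteq> []"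
  defines "I \<equiv> \<lambda>i. word_integral f (periodic_cfrac (W i)) (galois_conj (periodic_cfrac (W i))) (W i)"
  shows "\<exists>K. \<forall>a x y. x > 0 \<longrightarrow> - 1 < y \<longrightarrow> y < 0 \<longrightarrow>
    norm (word_integral f (moebius (word_matrix (composite_word k V W a)) x) y (composite_word k V W a)
       - (\<Sum>i=1..k. of_nat (a i) * I i)) \<le> K"
  using assms(2,3)
proof (induction k)
  case 0
  obtain K where "\<And>p q. norm (word_integral f p q (V 0)) \<le> K"
    using word_integral_bounded[OF f, of "V 0"] 0(1)[of 0] by auto
  then show ?case by (auto simp: composite_word_def)
next
  case (Suc k)
  let ?k = "Suc k"
  have "\<exists>K. \<forall>a x y. x > 0 \<longrightarrow> - 1 < y \<longrightarrow> y < 0 \<longrightarrow>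
    norm (word_integral f (moebius (word_matrix (composite_word k V W a)) x) y (composite_word k V W a)
       - (\<Sum>i=1..k. of_nat (a i) * I i)) \<le> K"
    using Suc.prems by (intro Suc.IH) auto
  then obtain K1 where K1: "\<And>a x y. x > 0 \<Longrightarrow> - 1 < y \<Longrightarrow> y < 0 \<Longrightarrow>
    norm (word_integral f (moebius (word_matrix (composite_word k V W a)) x) y (composite_word k V W a)
       - (\<Sum>i=1..k. of_nat (a i) * I i)) \<le> K1"
    by blast
  have W: "even_word (W ?k)" "W ?k \<noteq> []" and V: "even_word (V ?k)" using Suc.prems by auto
  obtain K2 where K2: "\<And>n x y. x > 0 \<Longrightarrow> - 1 < y \<Longrightarrow> y < 0 \<Longrightarrow>
    norm (word_integral f (moebius (word_matrix (word_power (W ?k) n)) x) y (word_power (W ?k) n)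
       - of_nat n * I ?k) \<le> K2"
    using word_power_integral_estimate[OF f W periodic_cfrac_fixpoints(1-4)[OF W]] unfolding I_def by blast
  obtain K3 where K3: "\<And>p q. norm (word_integral f p q (V ?k)) \<le> K3"
    using word_integral_bounded[OF f V] by blast
  have "norm (word_integral f (moebius (word_matrix (composite_word ?k V W a)) x) y (composite_word ?k V W a)
       - (\<Sum>i=1..?k. of_nat (a i) * I i)) \<le> K1 + (K2 + K3)"
    if xy: "x > 0" "- 1 < y" "y < 0" for a x y
  proof -
    \<comment> \<open>The word is \<open>C P V\<close>: the old composite word, the new power, the new connecting word. Removing
      factors from the left turns \<open>y\<close> into \<open>y1\<close> and \<open>y2\<close>, and \<open>x1\<close>, \<open>x2\<close> are the first poles that go
      with them.\<close>
    define C P where "C = composite_word k V W a" and "P = word_power (W ?k) (a ?k)"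
    have C: "even_word C" unfolding C_def using Suc.prems by (intro even_composite_word) auto
    have P: "even_word P" unfolding P_def using even_word_power[OF W(1)] .
    have PV: "even_word (P @ V ?k)" using even_word_append[OF P V] .
    define x1 where "x1 = moebius (word_matrix (V ?k)) x"
    have x1: "x1 > 0" unfolding x1_def using moebius_word_pos[OF even_word_pos[OF V] xy(1)] .
    define x2 where "x2 = moebius (word_matrix P) x1"
    have x2: "x2 > 0" unfolding x2_def using moebius_word_pos[OF even_word_pos[OF P] x1] .
    have m2: "moebius (word_matrix (P @ V ?k)) x = x2"
      unfolding x2_def x1_def by (rule moebius_word_append[OF even_word_pos[OF V] xy(1)])
    have m3: "moebius (word_matrix (C @ (P @ V ?k))) x = moebius (word_matrix C) x2"
      unfolding m2[symmetric] by (rule moebius_word_append[OF even_word_pos[OF PV] xy(1)])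
    define y1 where "y1 = inverse_moebius (word_matrix C) y"
    have y1: "- 1 < y1" "y1 < 0" using inverse_moebius_word(4,5)[OF C xy(2,3)] by (simp_all add: y1_def)
    define y2 where "y2 = inverse_moebius (word_matrix P) y1"
    have "word_integral f (moebius (word_matrix C) x2) y (C @ (P @ V ?k)) =
        word_integral f (moebius (word_matrix C) x2) y C +
        (word_integral f x2 y1 P + word_integral f x1 y2 (V ?k))"
      unfolding word_integral_append[OF f C PV x2 xy(2,3)] y1_def[symmetric]
      using word_integral_append[OF f P V x1 y1] by (simp add: x2_def y2_def)
    then have "word_integral f (moebius (word_matrix (composite_word ?k V W a)) x) y (composite_word ?k V W a)
       - (\<Sum>i=1..?k. of_nat (a i) * I i) =
       (word_integral f (moebius (word_matrix C) x2) y C - (\<Sum>i=1..k. of_nat (a i) * I i))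
       + ((word_integral f x2 y1 P - of_nat (a ?k) * I ?k) + word_integral f x1 y2 (V ?k))"
      unfolding composite_word_Suc C_def[symmetric] P_def[symmetric] m3 by simp
    also have "norm \<dots> \<le> K1 + (K2 + K3)"
      using K1[OF x2 xy(2,3), of a] K2[OF x1 y1, of "a ?k"] K3[of x1 y2]
      unfolding C_def[symmetric] P_def[symmetric] x2_def[symmetric]
      by (intro norm_triangle_mono)
    finally show ?thesis .
  qed
  then show ?case by blast
qed

section \<open>The limit\<close>

lemma word_integral_one_Re_pos:
  assumes W: "even_word W" "W \<noteq> []"
  shows "Re (word_integral (\<lambda>_. 1) (periodic_cfrac W) (galois_conj (periodic_cfrac W)) W) > 0"
proof -
  have e: "denom (word_matrix W) (periodic_cfrac W) > 1"
    using word_denom_gt_1(2)[OF W, of "periodic_cfrac W"] periodic_cfrac_fixpoints(2)[OF W] by simp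
  then show ?thesis
    unfolding word_integral_def
    using Re_segment_integral_one[OF det_word_matrix_even[OF W(1)] periodic_cfrac_fixpoints(1)[OF W] _ ii_upper]
    by simp
qed

text \<open>
  The composite word itself is covered by the preceding estimate at its own fixed points,
  \<open>x = w\<close> and \<open>y = w'\<close>, because \<open>M\<^sub>U w = w\<close>.
\<close>

lemma composite_word_integral_limit:
  assumes f: "holomorphic_SL2Z_invariant f" and k: "k \<ge> 1"
    and lim: "\<And>i. i \<in> {1..k} \<Longrightarrow> filterlim (a i) at_top sequentially"
    and ratio: "\<And>i. i \<in> {1..k} \<Longrightarrow>
           (\<lambda>n. real (a i n) / (\<Sum>j=1..k. real (a j n))) \<longlonglongrightarrow> \<alpha> i"
    and V: "\<And>i. i \<in> {0..k} \<Longrightarrow> even_word (V i)"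
    and W: "\<And>i. i \<in> {1..k} \<Longrightarrow> even_word (W i) \<and> W i \<noteq> []"
  defines "I \<equiv> \<lambda>U. word_integral f (periodic_cfrac U) (galois_conj (periodic_cfrac U)) U"
  shows "(\<lambda>n. I (composite_word k V W (\<lambda>i. a i n)) / of_real (\<Sum>j=1..k. real (a j n)))
    \<longlonglongrightarrow> (\<Sum>i=1..k. of_real (\<alpha> i) * I (W i))"
proof -
  define U where "U n = composite_word k V W (\<lambda>i. a i n)" for n
  define S where "S n = (\<Sum>j=1..k. real (a j n))" for n
  have S: "filterlim S at_top sequentially"
  proof (rule filterlim_at_top_mono)
    show "filterlim (\<lambda>n. real (a 1 n)) at_top sequentially"
      using lim[of 1] k by (intro filterlim_compose[OF filterlim_real_sequentially]) auto
    show "\<forall>\<^sub>F n in sequentially. real (a 1 n) \<le> S n"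
      unfolding S_def using k by (intro always_eventually allI member_le_sum) auto
  qed
  have Spos: "\<forall>\<^sub>F n in sequentially. S n > 0" using S by (simp add: filterlim_at_top_dense)
  have evenU: "even_word (U n)" for n
    unfolding U_def using V W by (intro even_composite_word) auto
  have "\<exists>K. \<forall>a x y. x > 0 \<longrightarrow> - 1 < y \<longrightarrow> y < 0 \<longrightarrow>
    norm (word_integral f (moebius (word_matrix (composite_word k V W a)) x) y (composite_word k V W a)
       - (\<Sum>i=1..k. of_nat (a i) * I (W i))) \<le> K"
    unfolding I_def using V W by (intro composite_word_integral_estimate[OF f]) auto
  then obtain K where K: "\<And>a x y. x > 0 \<Longrightarrow> - 1 < y \<Longrightarrow> y < 0 \<Longrightarrow>
    norm (word_integral f (moebius (word_matrix (composite_word k V W a)) x) y (composite_word k V W a)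
       - (\<Sum>i=1..k. of_nat (a i) * I (W i))) \<le> K"
    by blast
  define E where "E n = I (U n) - (\<Sum>i=1..k. of_nat (a i n) * I (W i))" for n
  have E: "norm (E n) \<le> K" if n: "S n > 0" for n
  proof -
    have "U n \<noteq> []"
      using composite_word_not_Nil[of k W "\<lambda>i. a i n" V] W n unfolding U_def S_def by auto
    note fp = periodic_cfrac_fixpoints[OF evenU this]
    have fixed: "moebius (word_matrix (U n)) (periodic_cfrac (U n)) = periodic_cfrac (U n)"
      by (rule fixpoint_pair_moebius[OF fp(1) det_word_matrix_even[OF evenU]])
    have "norm (word_integral f (moebius (word_matrix (U n)) (periodic_cfrac (U n)))
        (galois_conj (periodic_cfrac (U n))) (U n) - (\<Sum>i=1..k. of_nat (a i n) * I (W i))) \<le> K"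
      using fp(2-4) unfolding U_def by (intro K) auto
    then show ?thesis unfolding fixed E_def I_def .
  qed
  have K0: "(\<lambda>n. K / S n) \<longlonglongrightarrow> 0"
    using S by (intro real_tendsto_divide_at_top[OF tendsto_const])
  have "\<forall>\<^sub>F n in sequentially. norm (E n / of_real (S n)) \<le> K / S n"
    using Spos by eventually_elim (simp add: norm_divide divide_right_mono E)
  then have "(\<lambda>n. E n / of_real (S n)) \<longlonglongrightarrow> 0" by (rule Lim_null_comparison[OF _ K0])
  moreover have r: "(\<lambda>n. real (a i n) / S n) \<longlonglongrightarrow> \<alpha> i" if "i \<in> {1..k}" for i
    using ratio[OF that] unfolding S_def .
  have "(\<lambda>n. \<Sum>i=1..k. of_real (real (a i n) / S n) * I (W i)) \<longlonglongrightarrow> (\<Sum>i=1..k. of_real (\<alpha> i) * I (W i))"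
    by (intro tendsto_sum tendsto_mult tendsto_of_real tendsto_const r)
  ultimately have "(\<lambda>n. E n / of_real (S n) + (\<Sum>i=1..k. of_real (real (a i n) / S n) * I (W i)))
     \<longlonglongrightarrow> 0 + (\<Sum>i=1..k. of_real (\<alpha> i) * I (W i))" by (rule tendsto_add)
  moreover have "E n / of_real (S n) + (\<Sum>i=1..k. of_real (real (a i n) / S n) * I (W i)) = I (U n) / of_real (S n)" for n
    unfolding E_def diff_divide_distrib sum_divide_distrib by (simp add: mult.commute)
  ultimately show ?thesis unfolding U_def S_def by simp
qed

theorem theorem1p1:
  fixes f :: "complex \<Rightarrow> complex"
    and k :: nat
    and a :: "nat \<Rightarrow> nat \<Rightarrow> nat"
    and \<alpha> :: "nat \<Rightarrow> real"
    and V W :: "nat \<Rightarrow> nat list"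
  assumes "holomorphic_modular_function f"
    and "k \<ge> 1"
    and "\<And>i. i \<in> {1..k} \<Longrightarrow> filterlim (a i) at_top sequentially"
    and "\<And>i. i \<in> {1..k} \<Longrightarrow>
           (\<lambda>n. real (a i n) / (\<Sum>j=1..k. real (a j n))) \<longlonglongrightarrow> \<alpha> i"
    and "\<And>i. i \<in> {0..k} \<Longrightarrow> even_word (V i)"
    and "\<And>i. i \<in> {1..k} \<Longrightarrow> even_word (W i) \<and> W i \<noteq> []"
  shows "(\<lambda>n. quadratic_value f (periodic_cfrac (composite_word k V W (\<lambda>i. a i n))))
           \<longlonglongrightarrow>
         (\<Sum>i=1..k. of_real (\<alpha> i) * of_nat (word_exponent (W i)) *
              cycle_integral f (periodic_cfrac (W i))) /
         (\<Sum>i=1..k. of_real (\<alpha> i) * of_nat (word_exponent (W i)) *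
              cycle_integral (\<lambda>_. 1) (periodic_cfrac (W i)))"
proof -
  define S where "S n = (\<Sum>j=1..k. real (a j n))" for n
  define U where "U n = composite_word k V W (\<lambda>i. a i n)" for n
  define I where "I h X = word_integral h (periodic_cfrac X) (galois_conj (periodic_cfrac X)) X" for h X
  have f: "holomorphic_SL2Z_invariant f" "holomorphic_SL2Z_invariant (\<lambda>_. 1)"
    using assms(1) by (auto simp: holomorphic_SL2Z_invariant_def holomorphic_modular_function_def)
  have lim: "(\<lambda>n. I h (U n) / of_real (S n)) \<longlonglongrightarrow> (\<Sum>i=1..k. of_real (\<alpha> i) * I h (W i))"
    if "holomorphic_SL2Z_invariant h" for h
    unfolding I_def U_def S_def
    by (rule composite_word_integral_limit[OF that assms(2)]) (use assms(3-6) in auto)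
  have Spos: "\<forall>\<^sub>F n in sequentially. S n > 0"
  proof -
    have "\<forall>\<^sub>F n in sequentially. a 1 n \<ge> 1"
      using assms(2,3) by (simp add: filterlim_at_top)
    then show ?thesis
    proof eventually_elim
      case (elim n)
      have "real (a 1 n) \<le> S n" unfolding S_def using assms(2) by (intro member_le_sum) auto
      with elim show ?case by simp
    qed
  qed
  have \<alpha>: "\<alpha> i \<ge> 0" if "i \<in> {1..k}" for i
    using assms(4)[OF that] by (rule LIMSEQ_le_const) (auto intro!: divide_nonneg_nonneg sum_nonneg)
  have sum\<alpha>: "(\<Sum>i=1..k. \<alpha> i) = 1"
  proof -
    have "(\<lambda>n. \<Sum>i=1..k. real (a i n) / S n) \<longlonglongrightarrow> (\<Sum>i=1..k. \<alpha> i)"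
      using assms(4) unfolding S_def by (intro tendsto_sum) auto
    moreover have "\<forall>\<^sub>F n in sequentially. (\<Sum>i=1..k. real (a i n) / S n) = 1"
      using Spos by eventually_elim (simp add: S_def flip: sum_divide_distrib)
    then have "(\<lambda>n. \<Sum>i=1..k. real (a i n) / S n) \<longlonglongrightarrow> 1" by (rule tendsto_eventually)
    ultimately show ?thesis by (rule LIMSEQ_unique)
  qed
  have "Re (\<Sum>i=1..k. of_real (\<alpha> i) * I (\<lambda>_. 1) (W i)) > 0"
  proof -
    have "\<exists>i\<in>{1..k}. \<alpha> i > 0"
    proof (rule ccontr)
      assume "\<not> ?thesis"
      then have "\<alpha> i = 0" if "i \<in> {1..k}" for i using \<alpha>[OF that] that by force
      with sum\<alpha> show False by simp
    qed
    then obtain i where i: "i \<in> {1..k}" "\<alpha> i > 0" by blast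
    have pos: "Re (I (\<lambda>_. 1) (W j)) > 0" if "j \<in> {1..k}" for j
      unfolding I_def using word_integral_one_Re_pos assms(6)[OF that] by blast
    have "(\<Sum>j=1..k. \<alpha> j * Re (I (\<lambda>_. 1) (W j))) > 0"
      using i pos \<alpha> less_imp_le[OF pos] by (intro sum_pos2[of _ i] mult_nonneg_nonneg) auto
    then show ?thesis by simp
  qed
  then have nz: "(\<Sum>i=1..k. of_real (\<alpha> i) * I (\<lambda>_. 1) (W i)) \<noteq> 0"
    by (rule contrapos_pn) (simp only: zero_complex.sel less_irrefl not_False_eq_True)
  have "(\<lambda>n. (I f (U n) / of_real (S n)) / (I (\<lambda>_. 1) (U n) / of_real (S n))) \<longlonglongrightarrow>
    (\<Sum>i=1..k. of_real (\<alpha> i) * I f (W i)) / (\<Sum>i=1..k. of_real (\<alpha> i) * I (\<lambda>_. 1) (W i))"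
    by (rule tendsto_divide[OF lim[OF f(1)] lim[OF f(2)] nz])
  moreover have "\<forall>\<^sub>F n in sequentially.
    (I f (U n) / of_real (S n)) / (I (\<lambda>_. 1) (U n) / of_real (S n)) = quadratic_value f (periodic_cfrac (U n))"
    using Spos
  proof eventually_elim
    case (elim n)
    have U: "even_word (U n)" unfolding U_def using assms(5,6) by (intro even_composite_word) auto
    have "U n \<noteq> []"
      using composite_word_not_Nil[of k W "\<lambda>i. a i n" V] assms(6) elim unfolding U_def S_def by auto
    note cyc = cycle_integral_word[OF _ U this]
    have N: "word_exponent (U n) > 0" by (rule word_exponent_decompose[OF U \<open>U n \<noteq> []\<close>])
    show ?case
      using elim N unfolding I_def quadratic_value_def cyc[OF f(1), symmetric] cyc[OF f(2), symmetric] by simp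
  qed
  ultimately have "(\<lambda>n. quadratic_value f (periodic_cfrac (U n))) \<longlonglongrightarrow>
    (\<Sum>i=1..k. of_real (\<alpha> i) * I f (W i)) / (\<Sum>i=1..k. of_real (\<alpha> i) * I (\<lambda>_. 1) (W i))"
    by (rule Lim_transform_eventually)
  moreover have "of_real (\<alpha> i) * I h (W i) = of_real (\<alpha> i) * of_nat (word_exponent (W i)) * cycle_integral h (periodic_cfrac (W i))"
    if "holomorphic_SL2Z_invariant h" "i \<in> {1..k}" for h i
    unfolding I_def using cycle_integral_word[OF that(1)] assms(6)[OF that(2)] by (simp add: mult.assoc)
  ultimately show ?thesis using f unfolding U_def by simp
qed

end
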